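(* Let $G$ be a geometric surface-like pseudolattice with $\delta(G)=0$. Any exceptional basis in $G$ can be transformed by mutations into an exceptional basis consisting of elements of rank $1$.
   Context: A pseudolattice is a finitely generated free abelian group $G$ with a nondegenerate bilinear form $\chi:G\times G\to\mathbb{Z}$, not necessarily symmetric. It is unimodular if $\chi$ induces an isomorphism $G\to G^\vee$ (this is automatic if $G$ has an exceptional basis). Put $\chi_-(u,v)=\chi(u,v)-\chi(v,u)$. $G$ is surface-like if there is a primitive $p\in G$ (a point-like element, fixed as part of the structure) such that (1) $\chi(p,p)=0$; (2) $\chi_-(p,-)=0$; (3) $\chi_-$ vanishes on $p^\perp=\{v:\chi(p,v)=0\}$. The rank of $v\in G$ is $r(v)=\chi(p,v)=\chi(v,p)$, so $p^\perp=\ker r$. The Neron--Severi lattice is $NS(G)=p^\perp/\mathbb{Z}p$ with the (well defined, nondegenerate, symmetric, integral) intersection form $q(D_1,D_2)=D_1\cdot D_2:=-\chi(D_1,D_2)$ computed on lifts to $p^\perp$. For $v_1,v_2\in G$ let $\lambda(v_1,v_2)=r(v_1)v_2-r(v_2)v_1\in p^\perp$, regarded also as an element of $NS(G)$. The canonical class $K_G\in NS(G)\otimes\mathbb{Q}$ is the unique element with $\chi_-(v_1,v_2)=-q(K_G,\lambda(v_1,v_2))$ for all $v_1,v_2\in G$; $K_G^2$ means $q(K_G,K_G)$. $G$ is geometric if $K_G$ is integral (lies in $NS(G)$), $NS(G)$ has signature $(1,\mathrm{rk}\,NS(G)-1)$, and $D^2\equiv K_G\cdot D\pmod 2$ for all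 $D\in NS(G)$. The defect of a unimodular surface-like pseudolattice is $\delta(G)=K_G^2+\mathrm{rk}\,NS(G)-10$. An element $e\in G$ is exceptional if $\chi(e,e)=1$; a sequence $(e_1,\dots,e_m)$ is exceptional if all $e_i$ are exceptional and $\chi(e_i,e_j)=0$ for $i>j$; an exceptional basis is an exceptional sequence that is a basis of $G$. For exceptional $e$ put $L_e(v)=v-\chi(e,v)e$ and $R_e(v)=v-\chi(v,e)e$. A mutation of $(e_1,\dots,e_n)$ replaces a pair $(e_i,e_{i+1})$, $1\le i\le n-1$, by $(L_{e_i}(e_{i+1}),e_i)$ or by $(e_{i+1},R_{e_{i+1}}(e_i))$.
   Formalization: After the mutations, elements of the basis may be replaced by their negatives; without this the claim fails, e.g. for the basis (-O, -O(1), -O(2)) of K_0(P^2), whose ranks stay congruent to -1 mod 3 under all mutations. *)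

theory Defs
  imports "Jordan_Normal_Form.Matrix"
begin

section \<open>Pseudolattices\<close>

text \<open>The group \<open>G\<close> is a whole type of class \<^class>\<open>ab_group_add\<close>, regarded as a \<open>\<int>\<close>-module by
  \<open>zscale\<close>.\<close>

definition zscale :: "int \<Rightarrow> 'a::ab_group_add \<Rightarrow> 'a" where
  "zscale k x = (if 0 \<le> k then (\<Sum>i<nat k. x) else - (\<Sum>i<nat (- k). x))"

lemma zscale_of_nat [simp]: "zscale (int n) x = (\<Sum>i<n. x)"
  by (simp add: zscale_def)

lemma zscale_minus: "zscale (- k) x = - zscale k x"
  by (auto simp: zscale_def)

lemma zscale_Suc: "zscale (k + 1) x = zscale k x + x"
proof (cases "0 \<le> k")
  case True
  then have "nat (k + 1) = Suc (nat k)" by simp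
  with True show ?thesis by (simp add: zscale_def)
next
  case False
  then have "nat (- k) = Suc (nat (- (k + 1)))" by simp
  with False show ?thesis by (auto simp: zscale_def)
qed

lemma zscale_add_left: "zscale (k + l) x = zscale k x + zscale l x"
proof (induction l rule: int_induct [where k = 0])
  case base
  show ?case by (simp add: zscale_def)
next
  case (step1 i)
  then show ?case using zscale_Suc[of "k + i" x] zscale_Suc[of i x] by (simp add: algebra_simps)
next
  case (step2 i)
  then show ?case using zscale_Suc[of "k + (i - 1)" x] zscale_Suc[of "i - 1" x]
    by (simp add: algebra_simps)
qed

lemma zscale_add_right: "zscale k (x + y) = zscale k x + zscale k y"
  by (simp add: zscale_def sum.distrib)

lemma zscale_zscale: "zscale k (zscale l x) = zscale (k * l) x"
proof (induction k rule: int_induct [where k = 0])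
  case base
  show ?case by (simp add: zscale_def)
next
  case (step1 i)
  then show ?case using zscale_Suc[of i "zscale l x"] zscale_add_left[of "i * l" l x]
    by (simp add: algebra_simps)
next
  case (step2 i)
  then show ?case using zscale_Suc[of "i - 1" "zscale l x"] zscale_add_left[of "(i - 1) * l" l x]
    by (simp add: algebra_simps)
qed

interpretation zmod: Modules.module zscale
proof
  show "zscale 1 x = x" for x :: 'a
    using zscale_of_nat[of 1 x] by simp
qed (simp_all add: zscale_add_left zscale_add_right zscale_zscale)

definition is_zbasis :: "'a::ab_group_add list \<Rightarrow> bool" where
  "is_zbasis es \<longleftrightarrow>
     distinct es \<and> zmod.independent (set es) \<and> zmod.span (set es) = UNIV"

text \<open>Additivity in each argument is the same as \<open>\<int>\<close>-bilinearity.\<close>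

locale pseudolattice =
  fixes chi :: "'a::ab_group_add \<Rightarrow> 'a \<Rightarrow> int"
  assumes free_fin_gen: "\<exists>es :: 'a list. is_zbasis es"
    and add_left: "chi (u + v) w = chi u w + chi v w"
    and add_right: "chi u (v + w) = chi u v + chi u w"
    and nondegenerate_left: "(\<forall>v. chi u v = 0) \<Longrightarrow> u = 0"
    and nondegenerate_right: "(\<forall>u. chi u v = 0) \<Longrightarrow> v = 0"

definition chi_minus :: "('a::ab_group_add \<Rightarrow> 'a \<Rightarrow> int) \<Rightarrow> 'a \<Rightarrow> 'a \<Rightarrow> int" where
  "chi_minus chi u v = chi u v - chi v u"

definition primitive_elt :: "'a::ab_group_add \<Rightarrow> bool" where
  "primitive_elt p \<longleftrightarrow> p \<noteq> 0 \<and> (\<forall>k x. p = zscale k x \<longrightarrow> \<bar>k\<bar> = 1)"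

definition point_perp :: "('a::ab_group_add \<Rightarrow> 'a \<Rightarrow> int) \<Rightarrow> 'a \<Rightarrow> 'a set" where
  "point_perp chi p = {v. chi p v = 0}"

locale surface_like = pseudolattice chi
  for chi :: "'a::ab_group_add \<Rightarrow> 'a \<Rightarrow> int" +
  fixes p :: 'a
  assumes primitive_point: "primitive_elt p"
    and point_isotropic: "chi p p = 0"
    and chi_minus_point: "chi_minus chi p v = 0"
    and chi_minus_perp:
      "\<lbrakk>u \<in> point_perp chi p; v \<in> point_perp chi p\<rbrakk> \<Longrightarrow> chi_minus chi u v = 0"

definition elt_rank :: "('a::ab_group_add \<Rightarrow> 'a \<Rightarrow> int) \<Rightarrow> 'a \<Rightarrow> 'a \<Rightarrow> int" where
  "elt_rank chi p v = chi p v"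

section \<open>The Neron--Severi lattice\<close>

text \<open>Elements of \<open>NS(G)\<close> are cosets of \<open>\<int>p\<close> in \<open>p\<^sup>\<bottom>\<close>. The operations below are defined from
  representatives, on which the results do not depend.\<close>

definition ns_class :: "'a::ab_group_add \<Rightarrow> 'a \<Rightarrow> 'a set" where
  "ns_class p v = range (\<lambda>k. v + zscale k p)"

definition NS :: "('a::ab_group_add \<Rightarrow> 'a \<Rightarrow> int) \<Rightarrow> 'a \<Rightarrow> 'a set set" where
  "NS chi p = ns_class p ` point_perp chi p"

definition ns_add :: "'a::ab_group_add \<Rightarrow> 'a set \<Rightarrow> 'a set \<Rightarrow> 'a set" where
  "ns_add p D E = (\<Union>u\<in>D. \<Union>v\<in>E. ns_class p (u + v))"

definition ns_scale :: "'a::ab_group_add \<Rightarrow> int \<Rightarrow> 'a set \<Rightarrow> 'a set" where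
  "ns_scale p k D = (\<Union>u\<in>D. ns_class p (zscale k u))"

definition ns_form :: "('a::ab_group_add \<Rightarrow> 'a \<Rightarrow> int) \<Rightarrow> 'a set \<Rightarrow> 'a set \<Rightarrow> int" where
  "ns_form chi D E = (THE m. \<forall>u\<in>D. \<forall>v\<in>E. m = - chi u v)"

definition ns_lincomb :: "'a::ab_group_add \<Rightarrow> int list \<Rightarrow> 'a set list \<Rightarrow> 'a set" where
  "ns_lincomb p cs Ds = foldr (ns_add p) (map2 (ns_scale p) cs Ds) (ns_class p 0)"

definition ns_basis ::
    "('a::ab_group_add \<Rightarrow> 'a \<Rightarrow> int) \<Rightarrow> 'a \<Rightarrow> 'a set list \<Rightarrow> bool" where
  "ns_basis chi p Ds \<longleftrightarrow> set Ds \<subseteq> NS chi p \<and>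
     (\<forall>D\<in>NS chi p. \<exists>!cs. length cs = length Ds \<and> ns_lincomb p cs Ds = D)"

definition ns_rank :: "('a::ab_group_add \<Rightarrow> 'a \<Rightarrow> int) \<Rightarrow> 'a \<Rightarrow> nat" where
  "ns_rank chi p = (THE n. \<exists>Ds. ns_basis chi p Ds \<and> length Ds = n)"

text \<open>The signature of a real symmetric matrix is read off from its normal form under congruence
  (Sylvester); that of \<open>NS(G)\<close> is the signature of a Gram matrix.\<close>

definition has_signature :: "real mat \<Rightarrow> nat \<Rightarrow> nat \<Rightarrow> bool" where
  "has_signature M a b \<longleftrightarrow> a + b \<le> dim_row M \<and>
     (\<exists>P\<in>carrier_mat (dim_row M) (dim_row M). invertible_mat P \<and>
        transpose_mat P * M * P =
          mat_diag (dim_row M) (\<lambda>i. if i < a then 1 else if i < a + b then - 1 else 0))"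

definition ns_gram ::
    "('a::ab_group_add \<Rightarrow> 'a \<Rightarrow> int) \<Rightarrow> 'a set list \<Rightarrow> real mat" where
  "ns_gram chi Ds =
     mat (length Ds) (length Ds) (\<lambda>(i, j). real_of_int (ns_form chi (Ds ! i) (Ds ! j)))"

definition ns_has_signature ::
    "('a::ab_group_add \<Rightarrow> 'a \<Rightarrow> int) \<Rightarrow> 'a \<Rightarrow> nat \<Rightarrow> nat \<Rightarrow> bool" where
  "ns_has_signature chi p a b \<longleftrightarrow>
     (\<exists>Ds. ns_basis chi p Ds \<and> has_signature (ns_gram chi Ds) a b)"

section \<open>The canonical class\<close>

text \<open>\<open>NS(G) \<otimes> \<rat>\<close> is the localization of \<open>NS(G)\<close> at the nonzero integers. \<open>ns_frac chi p D m\<close> is the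
  fraction \<open>D/m\<close>, i.e. the class of \<open>(D, m)\<close> under \<open>(D, m) \<sim> (E, n) \<longleftrightarrow> n D = m E\<close>. This is an
  equivalence relation since \<open>NS(G)\<close> is torsion free, \<open>p\<close> being primitive.\<close>

definition ns_frac ::
    "('a::ab_group_add \<Rightarrow> 'a \<Rightarrow> int) \<Rightarrow> 'a \<Rightarrow> 'a set \<Rightarrow> int \<Rightarrow> ('a set \<times> int) set" where
  "ns_frac chi p D m = {(E, n). E \<in> NS chi p \<and> n \<noteq> 0 \<and> ns_scale p n D = ns_scale p m E}"

definition NSQ ::
    "('a::ab_group_add \<Rightarrow> 'a \<Rightarrow> int) \<Rightarrow> 'a \<Rightarrow> ('a set \<times> int) set set" where
  "NSQ chi p = {ns_frac chi p D m | D m. D \<in> NS chi p \<and> m \<noteq> 0}"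

definition ns_embed ::
    "('a::ab_group_add \<Rightarrow> 'a \<Rightarrow> int) \<Rightarrow> 'a \<Rightarrow> 'a set \<Rightarrow> ('a set \<times> int) set" where
  "ns_embed chi p D = ns_frac chi p D 1"

definition nsq_form ::
    "('a::ab_group_add \<Rightarrow> 'a \<Rightarrow> int) \<Rightarrow> ('a set \<times> int) set \<Rightarrow> ('a set \<times> int) set \<Rightarrow> rat" where
  "nsq_form chi X Y =
     (THE x. \<forall>(D, m)\<in>X. \<forall>(E, n)\<in>Y. x = of_int (ns_form chi D E) / of_int (m * n))"

definition lambda_elt :: "('a::ab_group_add \<Rightarrow> 'a \<Rightarrow> int) \<Rightarrow> 'a \<Rightarrow> 'a \<Rightarrow> 'a \<Rightarrow> 'a" where
  "lambda_elt chi p v1 v2 = zscale (elt_rank chi p v1) v2 - zscale (elt_rank chi p v2) v1"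

definition canonical_class ::
    "('a::ab_group_add \<Rightarrow> 'a \<Rightarrow> int) \<Rightarrow> 'a \<Rightarrow> ('a set \<times> int) set" where
  "canonical_class chi p = (THE K. K \<in> NSQ chi p \<and>
     (\<forall>v1 v2. of_int (chi_minus chi v1 v2) =
        - nsq_form chi K (ns_embed chi p (ns_class p (lambda_elt chi p v1 v2)))))"

definition geometric_pseudolattice :: "('a::ab_group_add \<Rightarrow> 'a \<Rightarrow> int) \<Rightarrow> 'a \<Rightarrow> bool" where
  "geometric_pseudolattice chi p \<longleftrightarrow> surface_like chi p \<and>
     ns_has_signature chi p 1 (ns_rank chi p - 1) \<and>
     (\<exists>K\<in>NS chi p. canonical_class chi p = ns_embed chi p K \<and>
        (\<forall>D\<in>NS chi p. ns_form chi D D mod 2 = ns_form chi K D mod 2))"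

text \<open>The defect is meant for unimodular \<open>G\<close>. The formula makes sense in general, and \<open>G\<close> is
  unimodular as soon as it has an exceptional basis.\<close>

definition defect :: "('a::ab_group_add \<Rightarrow> 'a \<Rightarrow> int) \<Rightarrow> 'a \<Rightarrow> rat" where
  "defect chi p = nsq_form chi (canonical_class chi p) (canonical_class chi p)
     + of_nat (ns_rank chi p) - 10"

section \<open>Exceptional bases and mutations\<close>

definition exceptional_seq ::
    "('a::ab_group_add \<Rightarrow> 'a \<Rightarrow> int) \<Rightarrow> 'a list \<Rightarrow> bool" where
  "exceptional_seq chi es \<longleftrightarrow>
     (\<forall>e\<in>set es. chi e e = 1) \<and> sorted_wrt (\<lambda>e f. chi f e = 0) es"

definition exceptional_basis ::
    "('a::ab_group_add \<Rightarrow> 'a \<Rightarrow> int) \<Rightarrow> 'a list \<Rightarrow> bool" where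
  "exceptional_basis chi es \<longleftrightarrow> exceptional_seq chi es \<and> is_zbasis es"

definition left_mut :: "('a::ab_group_add \<Rightarrow> 'a \<Rightarrow> int) \<Rightarrow> 'a \<Rightarrow> 'a \<Rightarrow> 'a" where
  "left_mut chi e v = v - zscale (chi e v) e"

definition right_mut :: "('a::ab_group_add \<Rightarrow> 'a \<Rightarrow> int) \<Rightarrow> 'a \<Rightarrow> 'a \<Rightarrow> 'a" where
  "right_mut chi e v = v - zscale (chi v e) e"

inductive mutation :: "('a::ab_group_add \<Rightarrow> 'a \<Rightarrow> int) \<Rightarrow> 'a list \<Rightarrow> 'a list \<Rightarrow> bool"
  for chi where
  left: "mutation chi (xs @ [e, f] @ ys) (xs @ [left_mut chi e f, e] @ ys)"
| right: "mutation chi (xs @ [e, f] @ ys) (xs @ [f, right_mut chi f e] @ ys)"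

text \<open>Exceptional elements are taken up to sign (in \<open>K\<^sub>0\<close>: exceptional objects up to shift), and this
  cannot be avoided for a basis with ranks equal to \<open>1\<close> rather than \<open>\<plusminus>1\<close>. For
  \<open>G = K\<^sub>0(\<bbbP>\<^sup>2)\<close> the Gram matrix of \<open>(- O, - O(1), - O(2))\<close> is the identity modulo 3, so mutations
  only permute this basis modulo 3 and all ranks stay congruent to \<open>- 1\<close>. Mutations commute with
  changes of sign up to sign, so it is enough to change signs at the end.\<close>

definition equal_up_to_signs :: "'a::ab_group_add list \<Rightarrow> 'a list \<Rightarrow> bool" where
  "equal_up_to_signs = list_all2 (\<lambda>f g. g = f \<or> g = - f)"

end

theory Submission
  imports Defs
begin

text \<open>
  The invariant that decides everything is the norm of an exceptional basis, the sum of the squares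
  of the ranks. Take a basis of least norm among those reachable by mutations. Elements of rank
  \<open>0\<close> can be moved to the end without changing the norm (\<open>mutations_zero_ranks_last\<close>), and the
  remaining elements \<open>f\<^sub>0, \<dots>, f\<^sub>m\<^sub>-\<^sub>1\<close>, of ranks \<open>r\<^sub>i \<noteq> 0\<close>, span the lattice of all \<open>v\<close> with
  \<open>\<chi>(z, v) = 0\<close> for the others \<open>z\<close>. It contains the point-like element and a canonical class \<open>k\<close> of
  its own (\<open>split_zero_ranks\<close>).

  The differences \<open>D\<^sub>i = f\<^sub>i\<^sub>+\<^sub>1/r\<^sub>i\<^sub>+\<^sub>1 - f\<^sub>i/r\<^sub>i\<close>, closed up cyclically by a class that makes their sum
  \<open>- k\<close>, intersect like the boundary divisors of a toric surface: only cyclic neighbours meet,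
  and \<open>D\<^sub>i\<^sub>-\<^sub>1 \<cdot> D\<^sub>i = 1/r\<^sub>i\<^sup>2\<close>. Since neither mutation of the pair \<open>(f\<^sub>i, f\<^sub>i\<^sub>+\<^sub>1)\<close> lowers
  the norm, either \<open>D\<^sub>i\<^sup>2 \<ge> \<bar>1/r\<^sub>i\<^sup>2 - 1/r\<^sub>i\<^sub>+\<^sub>1\<^sup>2\<bar>\<close> or \<open>- k \<cdot> D\<^sub>i \<le> 0\<close> (\<open>reduced_pair_dichotomy\<close>); for the
  closing pair this uses that one turn of the helix (\<open>helix_step\<close>) makes it adjacent and keeps the
  norm. In the second case the \<open>i\<close>-th ray vector of the fan lies in the triangle spanned by \<open>0\<close> and its two
  neighbours, so a maximum principle applies to linear functions on the fan and shows that the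
  indices with \<open>D\<^sub>i\<^sup>2 \<ge> 0\<close> do not fit into two neighbouring positions (\<open>nonneg_outside_pair\<close>). Hence
  \<open>m = 3\<close>, or there are two nonadjacent indices of this kind, and then the Hodge index property
  leaves only \<open>m = 4\<close> with both classes isotropic (\<open>hodge_nonadjacent\<close>).

  In these two cases \<open>k\<^sup>2\<close> is determined by the ranks. For \<open>m = 4\<close> the ranks
  are \<open>\<plusminus>x, \<plusminus>x, \<plusminus>y, \<plusminus>y\<close> in cyclic order and \<open>k\<^sup>2 = 4 (1/x\<^sup>2 + 1/y\<^sup>2)\<close>; for \<open>m = 3\<close> one gets
  \<open>k\<^sup>2 = (r\<^sub>0\<^sup>2 + r\<^sub>1\<^sup>2 + r\<^sub>2\<^sup>2)\<^sup>2 / (r\<^sub>0 r\<^sub>1 r\<^sub>2)\<^sup>2\<close>, so that a lower bound for \<open>k\<^sup>2\<close> is an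
  inequality of Markov type. On the other hand defect \<open>0\<close> gives \<open>k\<^sup>2 \<ge> 12 - m\<close>: the canonical
  class \<open>K\<close> of \<open>G\<close> has odd \<open>K \<cdot> z\<close> for each \<open>z\<close> of rank \<open>0\<close>, and splitting \<open>z\<close> off raises the
  square by \<open>(K \<cdot> z)\<^sup>2 \<ge> 1\<close>. Both cases then force all \<open>r\<^sub>i = \<plusminus>1\<close> and equality
  (\<open>ranks_are_units\<close>), so \<open>K \<cdot> z = \<plusminus>1\<close> for every \<open>z\<close>. Mutating such a \<open>z\<close> over an element of rank
  \<open>\<plusminus>1\<close> turns it into an element of rank \<open>\<plusminus>1\<close> (\<open>mutations_make_ranks_units\<close>), and signs are
  changed at the end.

  Throughout, \<open>NS(G)\<close> is handled through representatives in \<open>p\<^sup>\<bottom>\<close>, on which the intersection form is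
  \<open>- \<chi>\<close>, and the rational classes \<open>D\<^sub>i\<close> are multiplied by the product of all ranks.
\<close>


section \<open>Bilinear forms and exceptional sequences\<close>

lemma additive_zscale:
  assumes "additive f"
  shows "f (zscale k x) = zscale k (f x)"
proof -
  interpret additive f by fact
  show ?thesis by (simp add: zscale_def sum minus)
qed

lemma zscale_int [simp]: "zscale k (x :: int) = k * x"
  by (simp add: zscale_def)

lemma additive_int_zscale:
  fixes f :: "'a::ab_group_add \<Rightarrow> int"
  assumes "additive f"
  shows "f (zscale k x) = k * f x"
  using additive_zscale[OF assms] by simp

lemma additive_eq_on_span:
  assumes "additive f" "additive g" "\<And>e. e \<in> S \<Longrightarrow> f e = g e" "v \<in> zmod.span S"
  shows "f v = g v"
  using assms(4)
proof (induction rule: zmod.span_induct_alt)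
  case base
  show ?case using assms(1,2) by (simp add: additive.zero)
next
  case (step c x y)
  then show ?case
    using assms(1-3) by (simp add: additive.add additive_zscale)
qed

lemma span_list_obtain_coeffs:
  assumes "v \<in> zmod.span (set xs)"
  obtains b where "v = (\<Sum>i<length xs. zscale (b i) (xs ! i))"
proof -
  have "\<exists>b. v = (\<Sum>i<length xs. zscale (b i) (xs ! i))"
    using assms
  proof (induction rule: zmod.span_induct_alt)
    case base
    show ?case by (rule exI[of _ "\<lambda>_. 0"]) simp
  next
    case (step c x y)
    then obtain b where b: "y = (\<Sum>i<length xs. zscale (b i) (xs ! i))" by blast
    from step(1) obtain j where j: "j < length xs" "x = xs ! j" by (auto simp: in_set_conv_nth)
    have "zscale c x = (\<Sum>i<length xs. if i = j then zscale c (xs ! i) else 0)"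
      using j by simp
    also have "\<dots> = (\<Sum>i<length xs. zscale (if i = j then c else 0) (xs ! i))"
      by (rule sum.cong) auto
    finally show ?case
      unfolding b by (intro exI[of _ "\<lambda>i. (if i = j then c else 0) + b i"])
        (simp add: zmod.scale_left_distrib sum.distrib)
  qed
  then show ?thesis using that by blast
qed

context pseudolattice
begin

lemma chi_additive_left: "additive (\<lambda>u. chi u v)"
  by unfold_locales (rule add_left)

lemma chi_additive_right: "additive (\<lambda>v. chi u v)"
  by unfold_locales (rule add_right)

lemma chi_simps [simp]:
  "chi 0 v = 0" "chi u 0 = 0"
  "chi (- u) v = - chi u v" "chi u (- v) = - chi u v"
  "chi (zscale k u) v = k * chi u v" "chi u (zscale k v) = k * chi u v"
  using additive.zero[OF chi_additive_left, of v] additive.zero[OF chi_additive_right, of u]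
    additive.minus[OF chi_additive_left, of u v] additive.minus[OF chi_additive_right, of u v]
    additive_int_zscale[OF chi_additive_left, of k u v]
    additive_int_zscale[OF chi_additive_right, of u k v]
  by simp_all

lemma chi_diff [simp]:
  "chi (u - v) w = chi u w - chi v w" "chi u (v - w) = chi u v - chi u w"
  using additive.diff[OF chi_additive_left] additive.diff[OF chi_additive_right] by auto

lemma chi_sum:
  "chi (sum f A) w = (\<Sum>i\<in>A. chi (f i) w)" "chi u (sum f A) = (\<Sum>i\<in>A. chi u (f i))"
  using additive.sum[OF chi_additive_left] additive.sum[OF chi_additive_right] by auto

lemmas chi_add [simp] = add_left add_right

lemma chi_span_right_zero:
  assumes "\<And>e. e \<in> S \<Longrightarrow> chi u e = 0" "v \<in> zmod.span S"
  shows "chi u v = 0"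
proof -
  have "additive (\<lambda>_. 0 :: int)" by unfold_locales simp
  from additive_eq_on_span[OF chi_additive_right this _ assms(2)] assms(1) show ?thesis by simp
qed

lemma chi_span_left_zero:
  assumes "\<And>e. e \<in> S \<Longrightarrow> chi e v = 0" "u \<in> zmod.span S"
  shows "chi u v = 0"
proof -
  have "additive (\<lambda>_. 0 :: int)" by unfold_locales simp
  from additive_eq_on_span[OF chi_additive_left this _ assms(2)] assms(1) show ?thesis by simp
qed

lemma exceptional_seq_Cons:
  "exceptional_seq chi (e # es) \<longleftrightarrow>
     chi e e = 1 \<and> (\<forall>f\<in>set es. chi f e = 0) \<and> exceptional_seq chi es"
  by (auto simp: exceptional_seq_def)

lemma exceptional_seq_append:
  "exceptional_seq chi (xs @ ys) \<longleftrightarrow> exceptional_seq chi xs \<and> exceptional_seq chi ys \<and>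
     (\<forall>x\<in>set xs. \<forall>y\<in>set ys. chi y x = 0)"
  by (auto simp: exceptional_seq_def sorted_wrt_append)

lemma exceptional_seq_nth:
  assumes "exceptional_seq chi es"
  shows "i < length es \<Longrightarrow> chi (es ! i) (es ! i) = 1"
    and "j < i \<Longrightarrow> i < length es \<Longrightarrow> chi (es ! i) (es ! j) = 0"
  using assms by (auto simp: exceptional_seq_def sorted_wrt_iff_nth_less)

lemma exceptional_seq_distinct: "exceptional_seq chi es \<Longrightarrow> distinct es"
  by (induction es) (force simp: exceptional_seq_Cons)+

text \<open>The Gram matrix of an exceptional sequence is unitriangular: pairing a relation with the
  first element kills its coefficient there, and so on.\<close>

lemma exceptional_seq_independent:
  assumes "exceptional_seq chi es"
  shows "zmod.independent (set es)"
proof -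
  have "u v = 0"
    if "exceptional_seq chi es" "t \<subseteq> set es" "(\<Sum>v\<in>t. zscale (u v) v) = 0" "v \<in> t" for t u v
    using that
  proof (induction es arbitrary: t)
    case Nil
    then show ?case by simp
  next
    case (Cons e es)
    have fin: "finite t" using Cons.prems(2) finite_subset by blast
    have ue: "u e = 0" if "e \<in> t"
    proof -
      have "(\<Sum>v\<in>t. u v * chi v e) = 0"
        using arg_cong[OF Cons.prems(3), of "\<lambda>x. chi x e"] by (simp add: chi_sum)
      also have "(\<Sum>v\<in>t. u v * chi v e) = (\<Sum>v\<in>t. if v = e then u e else 0)"
        using Cons.prems(1,2) by (intro sum.cong) (auto simp: exceptional_seq_Cons)
      finally show ?thesis using fin that by simp
    qed
    have "(\<Sum>v\<in>t - {e}. zscale (u v) v) = 0"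
      using Cons.prems(3) fin ue by (cases "e \<in> t") (auto simp: sum.remove)
    then show ?case
      using Cons.IH[of "t - {e}"] Cons.prems ue by (cases "v = e") (auto simp: exceptional_seq_Cons)
  qed
  then show ?thesis
    using assms unfolding zmod.independent_explicit_module by blast
qed

lemma exceptional_basis_iff:
  "exceptional_basis chi es \<longleftrightarrow> exceptional_seq chi es \<and> zmod.span (set es) = UNIV"
  using exceptional_seq_distinct exceptional_seq_independent
  by (auto simp: exceptional_basis_def is_zbasis_def)

text \<open>Solving the same unitriangular system for an arbitrary right-hand side: every integral
  functional is represented by the form, which is unimodularity.\<close>

lemma exceptional_seq_represents:
  assumes "exceptional_seq chi es"
  shows "\<exists>k\<in>zmod.span (set es). \<forall>e\<in>set es. chi k e = (\<phi> e :: int)"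
  using assms
proof (induction es arbitrary: \<phi>)
  case Nil
  then show ?case by (auto intro: zmod.span_zero)
next
  case (Cons e es)
  then have "exceptional_seq chi es" by (simp add: exceptional_seq_Cons)
  from Cons.IH[OF this, of "\<lambda>x. \<phi> x - \<phi> e * chi e x"]
  obtain k where k: "k \<in> zmod.span (set es)"
      "\<forall>x\<in>set es. chi k x = \<phi> x - \<phi> e * chi e x" by blast
  have "chi k e = 0"
    using chi_span_left_zero[of "set es" e k] k(1) Cons.prems by (auto simp: exceptional_seq_Cons)
  moreover have "zscale (\<phi> e) e + k \<in> zmod.span (set (e # es))"
    using k(1) zmod.span_mono[of "set es" "set (e # es)"]
    by (intro zmod.span_add zmod.span_scale) (auto intro: zmod.span_base)
  ultimately show ?case
    using k(2) Cons.prems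
    by (intro bexI[of _ "zscale (\<phi> e) e + k"]) (auto simp: exceptional_seq_Cons)
qed

lemma unimodular:
  assumes "exceptional_basis chi es" "additive \<phi>"
  obtains k where "\<And>v. chi k v = (\<phi> v :: int)"
proof -
  obtain k where k: "\<forall>e\<in>set es. chi k e = \<phi> e"
    using exceptional_seq_represents assms(1) exceptional_basis_def by blast
  have "chi k v = \<phi> v" for v
    using additive_eq_on_span[OF chi_additive_right assms(2), of "set es" k v] k assms(1)
    by (auto simp: exceptional_basis_iff)
  then show ?thesis using that by blast
qed

end

section \<open>The Neron--Severi lattice through representatives\<close>

lemma ns_class_eq_iff: "ns_class p u = ns_class p v \<longleftrightarrow> (\<exists>k. u = v + zscale k p)"
proof
  assume "ns_class p u = ns_class p v"
  moreover have "u \<in> ns_class p u" unfolding ns_class_def by (rule range_eqI[of _ _ 0]) simp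
  ultimately show "\<exists>k. u = v + zscale k p" by (auto simp: ns_class_def)
next
  assume "\<exists>k. u = v + zscale k p"
  then obtain k where k: "u = v + zscale k p" by blast
  have "u + zscale l p = v + zscale (k + l) p" for l
    unfolding k by (simp only: zmod.scale_left_distrib add.assoc)
  moreover have "v + zscale l p = u + zscale (l - k) p" for l
    unfolding k by (simp add: zmod.scale_left_diff_distrib)
  ultimately show "ns_class p u = ns_class p v"
    unfolding ns_class_def by fast
qed

lemma in_ns_class_iff: "u \<in> ns_class p v \<longleftrightarrow> (\<exists>k. u = v + zscale k p)"
  by (auto simp: ns_class_def)

lemma ns_class_self: "u \<in> ns_class p u"
  by (auto simp: in_ns_class_iff intro: exI[of _ 0])

lemma ns_add_class: "ns_add p (ns_class p u) (ns_class p v) = ns_class p (u + v)"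
proof -
  have "ns_class p (u' + v') = ns_class p (u + v)"
    if uv: "u' \<in> ns_class p u" "v' \<in> ns_class p v" for u' v'
  proof -
    obtain k l where "u' = u + zscale k p" "v' = v + zscale l p"
      using uv unfolding in_ns_class_iff by blast
    then show ?thesis
      unfolding ns_class_eq_iff by (intro exI[of _ "k + l"]) (simp add: zmod.scale_left_distrib)
  qed
  then have "ns_add p (ns_class p u) (ns_class p v) =
      (\<Union>u'\<in>ns_class p u. \<Union>v'\<in>ns_class p v. ns_class p (u + v))"
    unfolding ns_add_def by (intro SUP_cong refl) simp
  then show ?thesis
    using ns_class_self[of u p] ns_class_self[of v p] by auto
qed

lemma ns_scale_class: "ns_scale p k (ns_class p u) = ns_class p (zscale k u)"
proof -
  have "ns_class p (zscale k u') = ns_class p (zscale k u)" if u: "u' \<in> ns_class p u" for u'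
  proof -
    obtain l where "u' = u + zscale l p" using u unfolding in_ns_class_iff by blast
    then show ?thesis
      unfolding ns_class_eq_iff by (intro exI[of _ "k * l"]) (simp add: zmod.scale_right_distrib)
  qed
  then have "ns_scale p k (ns_class p u) = (\<Union>u'\<in>ns_class p u. ns_class p (zscale k u))"
    unfolding ns_scale_def by (intro SUP_cong refl) simp
  then show ?thesis
    using ns_class_self[of u p] by auto
qed

lemma ns_lincomb_class:
  assumes "length cs = length ws"
  shows "ns_lincomb p cs (map (ns_class p) ws) =
    ns_class p (\<Sum>j<length ws. zscale (cs ! j) (ws ! j))"
proof -
  have "ns_lincomb p cs (map (ns_class p) ws) = ns_class p (sum_list (map2 zscale cs ws))"
    using assms by (induction cs ws rule: list_induct2)
      (simp_all add: ns_lincomb_def ns_scale_class ns_add_class)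
  then show ?thesis
    using assms by (simp add: sum_list_sum_nth atLeast0LessThan)
qed

text \<open>Invariance of the rank of a free abelian group, in the form needed for bases given by
  coordinate functionals: the sum computes the trace of the identity.\<close>

lemma trace_basis_independent:
  fixes \<beta> :: "'i \<Rightarrow> 'a::ab_group_add \<Rightarrow> int" and \<gamma> :: "'j \<Rightarrow> 'a \<Rightarrow> int"
  assumes fin: "finite I" "finite J"
    and add: "\<And>i. i \<in> I \<Longrightarrow> additive (\<beta> i)" "\<And>j. j \<in> J \<Longrightarrow> additive (\<gamma> j)"
    and eq: "\<And>v. v = (\<Sum>i\<in>I. zscale (\<beta> i v) (b i))" "\<And>v. v = (\<Sum>j\<in>J. zscale (\<gamma> j v) (c j))"
  shows "(\<Sum>i\<in>I. \<beta> i (b i)) = (\<Sum>j\<in>J. \<gamma> j (c j))"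
proof -
  have \<beta>_sum: "\<beta> i (\<Sum>j\<in>J. zscale (t j) (c j)) = (\<Sum>j\<in>J. t j * \<beta> i (c j))" if "i \<in> I" for i t
    by (simp add: additive.sum[OF add(1)[OF that]] additive_int_zscale[OF add(1)[OF that]])
  have \<gamma>_sum: "\<gamma> j (\<Sum>i\<in>I. zscale (t i) (b i)) = (\<Sum>i\<in>I. t i * \<gamma> j (b i))" if "j \<in> J" for j t
    by (simp add: additive.sum[OF add(2)[OF that]] additive_int_zscale[OF add(2)[OF that]])
  have "(\<Sum>i\<in>I. \<beta> i (b i)) = (\<Sum>i\<in>I. \<Sum>j\<in>J. \<gamma> j (b i) * \<beta> i (c j))"
    by (intro sum.cong refl) (simp only: \<beta>_sum[symmetric] eq(2)[symmetric])
  also have "\<dots> = (\<Sum>j\<in>J. \<Sum>i\<in>I. \<beta> i (c j) * \<gamma> j (b i))"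
    by (subst sum.swap) (simp add: mult.commute)
  also have "\<dots> = (\<Sum>j\<in>J. \<gamma> j (c j))"
    by (intro sum.cong refl) (simp only: \<gamma>_sum[symmetric] eq(1)[symmetric])
  finally show ?thesis .
qed

context surface_like
begin

lemma chi_point_commute: "chi v p = chi p v"
  using chi_minus_point[of v] by (simp add: chi_minus_def)

lemma chi_perp_commute: "chi p u = 0 \<Longrightarrow> chi p v = 0 \<Longrightarrow> chi u v = chi v u"
  using chi_minus_perp[of u v] by (simp add: chi_minus_def point_perp_def)

lemmas chi_point_self [simp] = point_isotropic

lemma ns_form_class:
  assumes "chi p u = 0" "chi p v = 0"
  shows "ns_form chi (ns_class p u) (ns_class p v) = - chi u v"
  unfolding ns_form_def
proof (rule the_equality)
  show "\<forall>u'\<in>ns_class p u. \<forall>v'\<in>ns_class p v. - chi u v = - chi u' v'"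
    using assms by (auto simp: in_ns_class_iff chi_point_commute[of u])
next
  fix m assume "\<forall>u'\<in>ns_class p u. \<forall>v'\<in>ns_class p v. m = - chi u' v'"
  then show "m = - chi u v" using ns_class_self by blast
qed

text \<open>If all ranks were divisible by \<open>g > 1\<close>, then by unimodularity the functional \<open>rank / g\<close> would be
  represented by an element \<open>k\<close> with \<open>p = g k\<close>, and \<open>p\<close> would not be primitive.\<close>

lemma exists_rank_one:
  assumes "exceptional_basis chi es"
  obtains v where "chi p v = 1"
proof -
  have pne: "p \<noteq> 0" using primitive_point by (simp add: primitive_elt_def)
  then obtain v0 where "chi p v0 \<noteq> 0" using nondegenerate_left by blast
  then have "chi p v0 > 0 \<or> chi p (- v0) > 0" by auto
  then obtain v1 where "chi p v1 > 0" by blast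
  then have "int (nat (chi p v1)) = chi p v1 \<and> nat (chi p v1) > 0" by simp
  then have ex: "\<exists>n::nat. \<exists>v. int n = chi p v \<and> n > 0" by blast
  define g where "g = (LEAST n::nat. \<exists>v. int n = chi p v \<and> n > 0)"
  obtain v where v: "int g = chi p v" "g > 0"
    using LeastI_ex[OF ex] unfolding g_def by blast
  have dvd: "int g dvd chi p w" for w
  proof (rule ccontr)
    assume "\<not> int g dvd chi p w"
    then have "chi p w mod int g \<noteq> 0" by (simp add: mod_eq_0_iff_dvd)
    moreover have "chi p w mod int g \<ge> 0" using v(2) by simp
    ultimately have pos: "chi p w mod int g > 0" by linarith
    have "chi p w mod int g = chi p (w - zscale (chi p w div int g) v)"
      using v(1) by (simp add: minus_div_mult_eq_mod)
    moreover have "chi p w mod int g < int g" using v(2) by simp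
    ultimately have "nat (chi p w mod int g) < g"
      "int (nat (chi p w mod int g)) = chi p (w - zscale (chi p w div int g) v)"
      "nat (chi p w mod int g) > 0"
      using pos by linarith+
    then show False
      using not_less_Least[of "nat (chi p w mod int g)" "\<lambda>n. \<exists>v. int n = chi p v \<and> n > 0"]
      unfolding g_def[symmetric] by blast
  qed
  have div_additive: "additive (\<lambda>w. chi p w div int g)"
    by unfold_locales (simp add: div_plus_div_distrib_dvd_left[OF dvd])
  obtain k where k: "\<And>w. chi k w = chi p w div int g"
    using unimodular[OF assms div_additive] by blast
  have "chi (zscale (int g) k - p) w = 0" for w
    using dvd[of w] by (simp add: k del: zscale_of_nat)
  then have "zscale (int g) k - p = 0" using nondegenerate_left by blast
  then have "p = zscale (int g) k" by simp
  then have "\<bar>int g\<bar> = 1" using primitive_point unfolding primitive_elt_def by blast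
  then have "chi p v = 1" using v(1) by simp
  then show ?thesis by (rule that)
qed

text \<open>Uniqueness of coordinates is phrased for arbitrary combinations, so that additivity of the
  coordinates follows from it.\<close>

lemma ns_basis_obtain_coordinates:
  assumes "ns_basis chi p Ds"
  obtains ws \<gamma> where "Ds = map (ns_class p) ws" "\<And>w. w \<in> set ws \<Longrightarrow> chi p w = 0"
    "\<And>w. chi p w = 0 \<Longrightarrow> \<exists>k. w = (\<Sum>j<length Ds. zscale (\<gamma> w j) (ws ! j)) + zscale k p"
    "\<And>w c k j. w = (\<Sum>j<length Ds. zscale (c j) (ws ! j)) + zscale k p \<Longrightarrow>
       j < length Ds \<Longrightarrow> \<gamma> w j = c j"
proof -
  have "\<forall>D\<in>set Ds. \<exists>w. chi p w = 0 \<and> D = ns_class p w"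
    using assms by (auto simp: ns_basis_def NS_def point_perp_def)
  then obtain rep where rep: "\<And>D. D \<in> set Ds \<Longrightarrow> chi p (rep D) = 0 \<and> D = ns_class p (rep D)"
    by metis
  define ws where "ws = map rep Ds"
  have "map (ns_class p) ws = Ds"
    unfolding ws_def map_map by (rule map_idI) (metis comp_apply rep)
  then have Ds: "Ds = map (ns_class p) ws" by (rule sym)
  have len: "length ws = length Ds" by (simp add: ws_def)
  have perp: "chi p w = 0" if w: "w \<in> set ws" for w
  proof -
    obtain D where "D \<in> set Ds" "w = rep D" using w by (auto simp: ws_def)
    then show ?thesis using rep by blast
  qed
  define \<gamma>l where "\<gamma>l w = (THE cs. length cs = length Ds \<and> ns_lincomb p cs Ds = ns_class p w)" for w
  have ex1: "\<exists>!cs. length cs = length Ds \<and> ns_lincomb p cs Ds = ns_class p w" if "chi p w = 0" for w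
  proof -
    have "ns_class p w \<in> NS chi p" using that by (simp add: NS_def point_perp_def)
    with assms show ?thesis unfolding ns_basis_def by (intro bspec[of _ _ "ns_class p w"]) simp_all
  qed
  have "\<exists>k. w = (\<Sum>j<length Ds. zscale (\<gamma>l w ! j) (ws ! j)) + zscale k p" if "chi p w = 0" for w
  proof -
    have "length (\<gamma>l w) = length Ds \<and> ns_lincomb p (\<gamma>l w) Ds = ns_class p w"
      unfolding \<gamma>l_def by (rule theI'[OF ex1[OF that]])
    then have "ns_class p w = ns_class p (\<Sum>j<length Ds. zscale (\<gamma>l w ! j) (ws ! j))"
      using ns_lincomb_class[of "\<gamma>l w" ws p] by (simp add: Ds[symmetric] len)
    then show ?thesis by (simp add: ns_class_eq_iff)
  qed
  moreover have "\<gamma>l w ! j = c j"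
    if w: "w = (\<Sum>j<length Ds. zscale (c j) (ws ! j)) + zscale k p" and j: "j < length Ds"
    for w c k j
  proof -
    have "chi p w = (\<Sum>j<length Ds. c j * chi p (ws ! j))"
      unfolding w by (simp add: chi_sum)
    also have "\<dots> = 0" by (intro sum.neutral) (simp add: perp len)
    finally have "chi p w = 0" .
    have "ns_lincomb p (map c [0..<length Ds]) Ds = ns_class p w"
      using ns_lincomb_class[of "map c [0..<length Ds]" ws p]
      by (auto simp: Ds[symmetric] len w ns_class_eq_iff intro!: exI[of _ "- k"])
    then have "\<gamma>l w = map c [0..<length Ds]"
      unfolding \<gamma>l_def using ex1[OF \<open>chi p w = 0\<close>] by (intro the1_equality) auto
    then show ?thesis using j by simp
  qed
  ultimately show ?thesis using that[of ws "\<lambda>w j. \<gamma>l w ! j"] Ds perp by blast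
qed

text \<open>A basis of the Neron--Severi lattice, the point-like element and an element of rank \<open>1\<close>
  together form a basis of the whole lattice, and the number of elements of a basis is the trace
  of the identity.\<close>

lemma ns_basis_length:
  assumes es: "exceptional_basis chi es" and Ds: "ns_basis chi p Ds"
  shows "length es = length Ds + 2"
proof -
  obtain v1 where v1: "chi p v1 = 1" using exists_rank_one[OF es] .
  obtain ws \<gamma> where ws: "Ds = map (ns_class p) ws" "\<And>w. w \<in> set ws \<Longrightarrow> chi p w = 0"
    and dec: "\<And>w. chi p w = 0 \<Longrightarrow> \<exists>k. w = (\<Sum>j<length Ds. zscale (\<gamma> w j) (ws ! j)) + zscale k p"
    and uniq: "\<And>w c k j. w = (\<Sum>j<length Ds. zscale (c j) (ws ! j)) + zscale k p \<Longrightarrow>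
       j < length Ds \<Longrightarrow> \<gamma> w j = c j"
    using ns_basis_obtain_coordinates[OF Ds] by blast
  have len: "length ws = length Ds" using ws(1) by simp
  let ?N = "length Ds"
  have \<gamma>_add: "\<gamma> (u + w) j = \<gamma> u j + \<gamma> w j"
    if perp: "chi p u = 0" "chi p w = 0" and j: "j < ?N" for u w j
  proof -
    obtain k where k: "u = (\<Sum>j<?N. zscale (\<gamma> u j) (ws ! j)) + zscale k p"
      using dec[OF perp(1)] by blast
    obtain l where l: "w = (\<Sum>j<?N. zscale (\<gamma> w j) (ws ! j)) + zscale l p"
      using dec[OF perp(2)] by blast
    have "u + w = (\<Sum>j<?N. zscale (\<gamma> u j) (ws ! j)) + zscale k p +
        ((\<Sum>j<?N. zscale (\<gamma> w j) (ws ! j)) + zscale l p)"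
      using k l by metis
    also have "\<dots> = (\<Sum>j<?N. zscale (\<gamma> u j + \<gamma> w j) (ws ! j)) + zscale (k + l) p"
      by (simp add: zmod.scale_left_distrib sum.distrib)
    finally show ?thesis by (rule uniq) (rule j)
  qed
  \<comment> \<open>\<open>red\<close> projects to \<open>p\<^sup>\<bottom>\<close> along \<open>v1\<close>; \<open>\<pi>\<close> is the coordinate at \<open>p\<close>, read off by pairing with \<open>v1\<close>.\<close>
  define red where "red v = v - zscale (chi p v) v1" for v
  have red_perp: "chi p (red v) = 0" for v using v1 by (simp add: red_def)
  have red_add: "red (u + v) = red u + red v" for u v
    by (simp add: red_def zmod.scale_left_distrib)
  define \<pi> where "\<pi> v = chi (red v - (\<Sum>j<?N. zscale (\<gamma> (red v) j) (ws ! j))) v1" for v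
  have decomp: "v = zscale (chi p v) v1 + (\<Sum>j<?N. zscale (\<gamma> (red v) j) (ws ! j)) + zscale (\<pi> v) p"
    for v
  proof -
    obtain k where k: "red v = (\<Sum>j<?N. zscale (\<gamma> (red v) j) (ws ! j)) + zscale k p"
      using dec[OF red_perp] by blast
    have "red v - (\<Sum>j<?N. zscale (\<gamma> (red v) j) (ws ! j)) = zscale k p"
      unfolding diff_eq_eq by (subst k) (rule add.commute)
    then have "\<pi> v = k" by (simp only: \<pi>_def) (simp add: v1)
    have "v = zscale (chi p v) v1 + red v" by (simp add: red_def)
    also have "\<dots> = zscale (chi p v) v1 + ((\<Sum>j<?N. zscale (\<gamma> (red v) j) (ws ! j)) + zscale k p)"
      by (rule arg_cong[OF k])
    finally show ?thesis using \<open>\<pi> v = k\<close> by (simp only: add.assoc)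
  qed
  define c where "c j = (if j < ?N then ws ! j else if j = ?N then v1 else p)" for j
  define \<delta> where "\<delta> j v = (if j < ?N then \<gamma> (red v) j else if j = ?N then chi p v else \<pi> v)" for j v
  have coord_add: "(\<Sum>j<?N. zscale (\<gamma> (red (u + v)) j) (ws ! j)) =
      (\<Sum>j<?N. zscale (\<gamma> (red u) j) (ws ! j)) + (\<Sum>j<?N. zscale (\<gamma> (red v) j) (ws ! j))" for u v
    unfolding sum.distrib[symmetric] zmod.scale_left_distrib[symmetric]
    by (intro sum.cong refl) (simp add: red_add \<gamma>_add red_perp)
  have "\<pi> (u + v) = \<pi> u + \<pi> v" for u v
    unfolding \<pi>_def coord_add by (simp add: red_add)
  then have \<delta>_add: "additive (\<delta> j)" for j
    by unfold_locales (simp add: \<delta>_def red_add \<gamma>_add red_perp)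
  have \<delta>_sum: "v = (\<Sum>j<Suc (Suc ?N). zscale (\<delta> j v) (c j))" for v
  proof -
    have "(\<Sum>j<?N. zscale (\<delta> j v) (c j)) = (\<Sum>j<?N. zscale (\<gamma> (red v) j) (ws ! j))"
      by (intro sum.cong) (auto simp: \<delta>_def c_def)
    then show ?thesis using decomp[of v] by (simp add: \<delta>_def c_def algebra_simps)
  qed
  have "\<delta> j (c j) = 1" if j: "j < Suc (Suc ?N)" for j
  proof -
    consider "j < ?N" | "j = ?N" | "j = Suc ?N" using j by linarith
    then show ?thesis
    proof cases
      case 1
      then have "red (ws ! j) = ws ! j" using ws(2) len by (simp add: red_def)
      moreover have "ws ! j = (\<Sum>i<?N. zscale (if i = j then 1 else 0) (ws ! i)) + zscale 0 p"
      proof -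
        have "(\<Sum>i<?N. zscale (if i = j then 1 else 0) (ws ! i)) =
            (\<Sum>i<?N. if i = j then ws ! i else 0)" by (rule sum.cong) auto
        then show ?thesis using 1 by simp
      qed
      ultimately show ?thesis using 1 uniq[of "ws ! j" "\<lambda>i. if i = j then 1 else 0" 0 j]
        by (simp add: \<delta>_def c_def)
    next
      case 2
      then show ?thesis using v1 by (simp add: \<delta>_def c_def)
    next
      case 3
      have "\<gamma> p i = 0" if "i < ?N" for i
        using uniq[of p "\<lambda>_. 0" 1 i] that by simp
      then show ?thesis using 3 v1 by (simp add: \<delta>_def c_def \<pi>_def red_def)
    qed
  qed
  then have "(\<Sum>j<Suc (Suc ?N). \<delta> j (c j)) = int ?N + 2" by simp
  \<comment> \<open>The coordinates with respect to the exceptional basis are pairings with a dual basis.\<close>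
  moreover have "\<exists>k. \<forall>j<length es. chi k (es ! j) = (if j = i then 1 else 0)"
    if "i < length es" for i
  proof -
    have "distinct es" using es by (simp add: exceptional_basis_def is_zbasis_def)
    moreover obtain k where "\<forall>e\<in>set es. chi k e = (if e = es ! i then 1 else 0)"
      using exceptional_seq_represents[of es "\<lambda>e. if e = es ! i then 1 else 0"] es
      by (auto simp: exceptional_basis_def)
    ultimately show ?thesis using that by (metis nth_eq_iff_index_eq nth_mem)
  qed
  then obtain k where k: "\<And>i j. i < length es \<Longrightarrow> j < length es \<Longrightarrow>
      chi (k i) (es ! j) = (if j = i then 1 else 0)"
    by metis
  have "v = (\<Sum>i<length es. zscale (chi (k i) v) (es ! i))" for v
  proof (rule additive_eq_on_span[of "\<lambda>v. v" "\<lambda>v. \<Sum>i<length es. zscale (chi (k i) v) (es ! i)" "set es"])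
    show "e = (\<Sum>i<length es. zscale (chi (k i) e) (es ! i))" if e: "e \<in> set es" for e
    proof -
      obtain j where j: "j < length es" "e = es ! j" using e by (auto simp: in_set_conv_nth)
      have "(\<Sum>i<length es. zscale (chi (k i) e) (es ! i)) = (\<Sum>i<length es. if i = j then es ! i else 0)"
        using k j by (intro sum.cong) auto
      then show ?thesis using j by simp
    qed
    show "v \<in> zmod.span (set es)" using es by (simp add: exceptional_basis_iff)
  qed (unfold_locales, simp_all add: zmod.scale_left_distrib sum.distrib)
  then have "(\<Sum>i<length es. chi (k i) (es ! i)) = (\<Sum>j<Suc (Suc ?N). \<delta> j (c j))"
    using \<delta>_add \<delta>_sum chi_additive_right by (intro trace_basis_independent) auto
  moreover have "(\<Sum>i<length es. chi (k i) (es ! i)) = int (length es)" using k by simp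
  ultimately show ?thesis by simp
qed

lemma ns_rank_eq:
  assumes "exceptional_basis chi es" "ns_basis chi p Ds"
  shows "ns_rank chi p = length Ds" "length es = ns_rank chi p + 2"
proof -
  show "ns_rank chi p = length Ds"
    unfolding ns_rank_def
  proof (rule the_equality)
    show "\<exists>Ds'. ns_basis chi p Ds' \<and> length Ds' = length Ds" using assms(2) by blast
    show "n = length Ds" if n: "\<exists>Ds'. ns_basis chi p Ds' \<and> length Ds' = n" for n
    proof -
      obtain Ds' where Ds': "ns_basis chi p Ds'" "length Ds' = n" using n by blast
      then show ?thesis using ns_basis_length[OF assms(1) Ds'(1)] ns_basis_length[OF assms] by simp
    qed
  qed
  then show "length es = ns_rank chi p + 2" using ns_basis_length[OF assms] by simp
qed

end

section \<open>The canonical class and the Hodge index property\<close>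

text \<open>The element \<open>kap\<close> lifts the canonical class: on representatives,
  \<open>- K \<cdot> \<lambda>(u, v)\<close> is \<open>\<chi>(kap, r(u) v - r(v) u)\<close>.\<close>

locale canonical_surface = surface_like chi p
  for chi :: "'a::ab_group_add \<Rightarrow> 'a \<Rightarrow> int" and p :: 'a +
  fixes kap :: 'a
  assumes kap_perp: "chi p kap = 0"
    and chi_asym: "chi u v - chi v u = chi p u * chi kap v - chi p v * chi kap u"

context surface_like
begin

lemma zscale_eq_0_iff:
  fixes z :: 'a
  shows "zscale m z = 0 \<longleftrightarrow> m = 0 \<or> z = 0"
proof
  assume "zscale m z = 0"
  then have "m * chi z u = 0" for u using chi_simps(5)[of m z u] by simp
  then show "m = 0 \<or> z = 0" using nondegenerate_left[of z] by auto
qed auto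

lemma perp_orthogonal_is_multiple:
  assumes v1: "chi p v1 = 1" and x: "chi p x = 0" "\<And>w. chi p w = 0 \<Longrightarrow> chi x w = 0"
  shows "x = zscale (chi x v1) p"
proof -
  have "chi (x - zscale (chi x v1) p) v = 0" for v
  proof -
    have "chi x (v - zscale (chi p v) v1) = 0" using v1 by (intro x(2)) simp
    then show ?thesis by (simp add: mult.commute)
  qed
  then have "x - zscale (chi x v1) p = 0" using nondegenerate_left by blast
  then show ?thesis by (simp only: right_minus_eq)
qed

lemma in_ns_frac_class_iff:
  "(E, n) \<in> ns_frac chi p (ns_class p a) m \<longleftrightarrow>
     n \<noteq> 0 \<and> (\<exists>e. chi p e = 0 \<and> E = ns_class p e \<and> ns_class p (zscale n a) = ns_class p (zscale m e))"
proof -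
  have "E \<in> NS chi p \<longleftrightarrow> (\<exists>e. chi p e = 0 \<and> E = ns_class p e)"
    unfolding NS_def point_perp_def by blast
  then have "(E, n) \<in> ns_frac chi p (ns_class p a) m \<longleftrightarrow> n \<noteq> 0 \<and>
      (\<exists>e. chi p e = 0 \<and> E = ns_class p e \<and> ns_scale p n (ns_class p a) = ns_scale p m E)"
    unfolding ns_frac_def by blast
  then show ?thesis by (simp add: ns_scale_class cong: conj_cong)
qed

lemma nsq_form_frac:
  assumes a: "chi p a = 0" and b: "chi p b = 0" and mn: "m \<noteq> 0" "n \<noteq> 0"
  shows "nsq_form chi (ns_frac chi p (ns_class p a) m) (ns_frac chi p (ns_class p b) n) =
    of_int (- chi a b) / of_int (m * n)"
  unfolding nsq_form_def
proof (rule the_equality)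
  have "(of_int (- chi a b) / of_int (m * n) :: rat) = of_int (ns_form chi E F) / of_int (k * l)"
    if EF: "(E, k) \<in> ns_frac chi p (ns_class p a) m" "(F, l) \<in> ns_frac chi p (ns_class p b) n"
    for E k F l
  proof -
    obtain e s where e: "k \<noteq> 0" "chi p e = 0" "E = ns_class p e" "zscale k a = zscale m e + zscale s p"
      using EF(1) unfolding in_ns_frac_class_iff ns_class_eq_iff[of p "zscale _ _"] by blast
    obtain f t where f: "l \<noteq> 0" "chi p f = 0" "F = ns_class p f" "zscale l b = zscale n f + zscale t p"
      using EF(2) unfolding in_ns_frac_class_iff ns_class_eq_iff[of p "zscale _ _"] by blast
    have "k * l * chi a b = chi (zscale k a) (zscale l b)" by simp
    also have "\<dots> = m * n * chi e f"
      unfolding e(4) f(4) using e(2) f(2) by (simp add: chi_point_commute[of e])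
    finally have "(of_int (k * l * chi a b) :: rat) = of_int (m * n * chi e f)" by simp
    then show ?thesis
      using e f mn by (simp add: ns_form_class field_simps)
  qed
  then show "\<forall>(D, k)\<in>ns_frac chi p (ns_class p a) m. \<forall>(E, l)\<in>ns_frac chi p (ns_class p b) n.
      of_int (- chi a b) / of_int (m * n) = of_int (ns_form chi D E) / (of_int (k * l) :: rat)"
    by blast
next
  fix x :: rat
  assume "\<forall>(D, k)\<in>ns_frac chi p (ns_class p a) m. \<forall>(E, l)\<in>ns_frac chi p (ns_class p b) n.
      x = of_int (ns_form chi D E) / of_int (k * l)"
  moreover have "(ns_class p a, m) \<in> ns_frac chi p (ns_class p a) m"
    "(ns_class p b, n) \<in> ns_frac chi p (ns_class p b) n"
    using assms by (auto simp: in_ns_frac_class_iff)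
  ultimately have "x = of_int (ns_form chi (ns_class p a) (ns_class p b)) / of_int (m * n)" by blast
  then show "x = of_int (- chi a b) / of_int (m * n)" using a b by (simp add: ns_form_class)
qed

lemma ns_class_zscale_eq_iff:
  assumes v1: "chi p v1 = 1" and m: "m \<noteq> 0"
  shows "ns_class p (zscale m x) = ns_class p (zscale m y) \<longleftrightarrow> ns_class p x = ns_class p y"
proof
  assume "ns_class p (zscale m x) = ns_class p (zscale m y)"
  then obtain k where "zscale m x = zscale m y + zscale k p" by (auto simp: ns_class_eq_iff)
  then have k: "zscale m (x - y) = zscale k p" by (simp add: zmod.scale_right_diff_distrib)
  then have "chi (zscale m (x - y)) v1 = chi (zscale k p) v1" by simp
  then have "k = m * chi (x - y) v1" using v1 by simp
  then have "zscale m (x - y) = zscale m (zscale (chi (x - y) v1) p)"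
    unfolding k zmod.scale_scale by (rule arg_cong)
  then have "zscale m (x - y - zscale (chi (x - y) v1) p) = 0"
    unfolding zmod.scale_right_diff_distrib[of m "x - y"] by (simp only: right_minus_eq)
  then have "x - y = zscale (chi (x - y) v1) p"
    using m unfolding zscale_eq_0_iff right_minus_eq by blast
  then show "ns_class p x = ns_class p y"
    unfolding ns_class_eq_iff by (intro exI[of _ "chi (x - y) v1"]) (simp add: algebra_simps)
qed (simp flip: ns_scale_class)

text \<open>By unimodularity the functional \<open>\<chi>\<^sub>-(v, _)\<close>, where \<open>v\<close> has rank \<open>1\<close>, is represented by an
  element, which is orthogonal to the point-like element and represents the canonical class.\<close>

lemma exists_canonical_surface:
  assumes es: "exceptional_basis chi es"
  obtains kap where "canonical_surface chi p kap"
proof -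
  obtain v1 where v1: "chi p v1 = 1" using exists_rank_one[OF es] .
  have add: "additive (\<lambda>v. chi v1 v - chi v v1)" by unfold_locales simp
  obtain kap where kap: "\<And>v. chi kap v = chi v1 v - chi v v1"
    using unimodular[OF es add] by blast
  have "chi p kap = 0" using kap[of p] chi_point_commute[of kap] chi_point_commute[of v1] by simp
  moreover have "chi u v - chi v u = chi p u * chi kap v - chi p v * chi kap u" for u v
  proof -
    let ?u = "u - zscale (chi p u) v1" and ?v = "v - zscale (chi p v) v1"
    have "chi ?u ?v = chi ?v ?u" using v1 by (intro chi_perp_commute) simp_all
    then show ?thesis by (simp add: kap algebra_simps)
  qed
  ultimately have "canonical_surface chi p kap" by unfold_locales
  then show ?thesis by (rule that)
qed

end

context canonical_surface
begin

text \<open>Uniqueness is tested on \<open>\<lambda>(v, w) = w\<close> for \<open>w\<close> in \<open>p\<^sup>\<bottom>\<close> and \<open>v\<close> of rank \<open>1\<close>, since the form on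
  \<open>p\<^sup>\<bottom>\<close> has kernel \<open>\<int>p\<close>.\<close>

lemma canonical_class_eq:
  assumes v1: "chi p v1 = 1"
  shows "canonical_class chi p = ns_embed chi p (ns_class p kap)"
  unfolding canonical_class_def
proof (rule the_equality, intro conjI allI)
  show "ns_embed chi p (ns_class p kap) \<in> NSQ chi p"
  proof -
    have "ns_class p kap \<in> NS chi p" using kap_perp by (simp add: NS_def point_perp_def)
    then show ?thesis unfolding ns_embed_def NSQ_def using zero_neq_one[symmetric] by blast
  qed
next
  fix u v
  have "chi p (lambda_elt chi p u v) = 0" by (simp add: lambda_elt_def elt_rank_def)
  then have "nsq_form chi (ns_embed chi p (ns_class p kap))
      (ns_embed chi p (ns_class p (lambda_elt chi p u v))) = of_int (- chi kap (lambda_elt chi p u v))"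
    unfolding ns_embed_def using nsq_form_frac[of kap "lambda_elt chi p u v" 1 1] kap_perp by simp
  moreover have "chi_minus chi u v = chi kap (lambda_elt chi p u v)"
    unfolding chi_minus_def chi_asym by (simp add: lambda_elt_def elt_rank_def)
  ultimately show "of_int (chi_minus chi u v) = - nsq_form chi (ns_embed chi p (ns_class p kap))
      (ns_embed chi p (ns_class p (lambda_elt chi p u v)))" by simp
next
  fix K assume K: "K \<in> NSQ chi p \<and> (\<forall>u v. of_int (chi_minus chi u v) =
    - nsq_form chi K (ns_embed chi p (ns_class p (lambda_elt chi p u v))))"
  then obtain d m where d: "chi p d = 0" "m \<noteq> 0" "K = ns_frac chi p (ns_class p d) m"
    unfolding NSQ_def NS_def point_perp_def by blast
  have "chi (d - zscale m kap) w = 0" if w: "chi p w = 0" for w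
  proof -
    have "lambda_elt chi p v1 w = w" using v1 w by (simp add: lambda_elt_def elt_rank_def)
    then have "(of_int (chi_minus chi v1 w) :: rat) = - nsq_form chi K (ns_frac chi p (ns_class p w) 1)"
      using K[THEN conjunct2, rule_format, of v1 w] by (simp add: ns_embed_def)
    also have "\<dots> = of_int (chi d w) / of_int m"
      unfolding d(3) using nsq_form_frac[OF d(1) w d(2), of 1] by simp
    also have "chi_minus chi v1 w = chi kap w"
      unfolding chi_minus_def chi_asym using v1 w by simp
    finally have "(of_int (m * chi kap w) :: rat) = of_int (chi d w)" using d(2) by (simp add: field_simps)
    then have "m * chi kap w = chi d w" by (simp only: of_int_eq_iff)
    then show ?thesis by simp
  qed
  then have "d - zscale m kap = zscale (chi (d - zscale m kap) v1) p"
    by (intro perp_orthogonal_is_multiple v1) (simp_all add: d kap_perp)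
  then have "d = zscale m kap + zscale (chi (d - zscale m kap) v1) p"
    unfolding diff_eq_eq by (subst add.commute)
  then obtain t where t: "d = zscale m kap + zscale t p" by blast
  have "ns_class p (zscale n d) = ns_class p (zscale m (zscale n kap))" for n
    unfolding ns_class_eq_iff t
    by (intro exI[of _ "n * t"]) (simp add: zmod.scale_right_distrib mult.commute)
  then have "(E, n) \<in> ns_frac chi p (ns_class p d) m \<longleftrightarrow>
      (E, n) \<in> ns_frac chi p (ns_class p kap) 1" for E n
    using ns_class_zscale_eq_iff[OF v1 d(2), of "zscale n kap"]
    unfolding in_ns_frac_class_iff by simp
  then show "K = ns_embed chi p (ns_class p kap)"
    unfolding d(3) ns_embed_def by (intro equalityI subrelI) simp_all
qed

end

text \<open>The signature enters only as follows: a class of nonnegative square that is orthogonal to a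
  class of positive square is numerically trivial.\<close>

locale geometric_surface = canonical_surface chi p kap
  for chi :: "'a::ab_group_add \<Rightarrow> 'a \<Rightarrow> int" and p kap :: 'a +
  assumes hodge_index: "\<lbrakk>chi p u = 0; chi p v = 0; chi p w = 0; chi u u < 0; chi u v = 0; chi v v \<le> 0\<rbrakk>
      \<Longrightarrow> chi v w = 0"
    and parity: "chi p v = 0 \<Longrightarrow> even (chi v v - chi kap v)"

text \<open>If \<open>u\<close> is positive and orthogonal to \<open>v\<close>, the sum of the \<open>e i * (v 0 * u i - u 0 * v i)\<^sup>2\<close> is
  negative unless \<open>v 0 = 0\<close>.\<close>

lemma lorentzian_orthogonal:
  fixes u v w e :: "nat \<Rightarrow> real"
  assumes e: "\<And>i. i \<in> I \<Longrightarrow> e i \<ge> 0" and fin: "finite I"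
    and u: "u 0 * u 0 > (\<Sum>i\<in>I. e i * (u i * u i))"
    and uv: "u 0 * v 0 = (\<Sum>i\<in>I. e i * (u i * v i))"
    and v: "v 0 * v 0 \<ge> (\<Sum>i\<in>I. e i * (v i * v i))"
  shows "v 0 * w 0 = (\<Sum>i\<in>I. e i * (v i * w i))"
proof -
  define A B C where "A = (\<Sum>i\<in>I. e i * (u i * u i))" and "B = (\<Sum>i\<in>I. e i * (v i * v i))"
    and "C = (\<Sum>i\<in>I. e i * (u i * v i))"
  have "0 \<le> (\<Sum>i\<in>I. e i * (v 0 * u i - u 0 * v i)\<^sup>2)"
    using e by (intro sum_nonneg) simp
  also have "(\<Sum>i\<in>I. e i * (v 0 * u i - u 0 * v i)\<^sup>2) =
      (v 0)\<^sup>2 * A - 2 * (u 0 * v 0) * C + (u 0)\<^sup>2 * B"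
    unfolding A_def B_def C_def sum_distrib_left sum_subtractf[symmetric] sum.distrib[symmetric]
    by (rule sum.cong) (simp_all add: power2_eq_square algebra_simps)
  also have "C = u 0 * v 0" using uv by (simp add: C_def)
  also have "(v 0)\<^sup>2 * A - 2 * (u 0 * v 0) * (u 0 * v 0) + (u 0)\<^sup>2 * B \<le> (v 0)\<^sup>2 * (A - (u 0)\<^sup>2)"
    using mult_left_mono[of B "(v 0)\<^sup>2" "(u 0)\<^sup>2"] v
    by (simp add: B_def power2_eq_square algebra_simps)
  finally have "0 \<le> (v 0)\<^sup>2 * (A - (u 0)\<^sup>2)" .
  moreover have "A - (u 0)\<^sup>2 < 0" using u by (simp add: A_def power2_eq_square)
  ultimately have v0: "v 0 = 0"
    using mult_pos_neg[of "(v 0)\<^sup>2" "A - (u 0)\<^sup>2"] by (cases "v 0 = 0") auto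
  have "B = 0"
    using v v0 e unfolding B_def by (intro antisym sum_nonneg) simp_all
  then have "e i * (v i * v i) = 0" if "i \<in> I" for i
    using that e fin unfolding B_def by (subst (asm) sum_nonneg_eq_0_iff) auto
  then have "(\<Sum>i\<in>I. e i * (v i * w i)) = 0" by (intro sum.neutral) auto
  then show ?thesis using v0 by simp
qed

context surface_like
begin

text \<open>Sylvester's normal form provides real linear functionals that diagonalize the form.\<close>

lemma signature_imp_diagonal:
  assumes Ds: "ns_basis chi p Ds" and sig: "has_signature (ns_gram chi Ds) a b"
  obtains \<phi> :: "nat \<Rightarrow> 'a \<Rightarrow> real" where
    "\<And>u v. chi p u = 0 \<Longrightarrow> chi p v = 0 \<Longrightarrow> real_of_int (- chi u v) =
       (\<Sum>i<length Ds. (if i < a then 1 else if i < a + b then - 1 else 0) * (\<phi> i u * \<phi> i v))"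
proof -
  define N where "N = length Ds"
  define f :: "nat \<Rightarrow> real" where "f i = (if i < a then 1 else if i < a + b then - 1 else 0)" for i
  obtain ws \<gamma> where ws: "Ds = map (ns_class p) ws" "\<And>w. w \<in> set ws \<Longrightarrow> chi p w = 0"
    and dec: "\<And>w. chi p w = 0 \<Longrightarrow> \<exists>k. w = (\<Sum>j<length Ds. zscale (\<gamma> w j) (ws ! j)) + zscale k p"
    and "\<And>w c k j. w = (\<Sum>j<length Ds. zscale (c j) (ws ! j)) + zscale k p \<Longrightarrow>
       j < length Ds \<Longrightarrow> \<gamma> w j = c j"
    using ns_basis_obtain_coordinates[OF Ds] by blast
  have len: "length ws = N" unfolding N_def ws(1) by simp
  define M where "M = ns_gram chi Ds"
  have M: "M \<in> carrier_mat N N" by (simp add: M_def ns_gram_def N_def)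
  then obtain P where P: "P \<in> carrier_mat N N" "invertible_mat P"
      "transpose_mat P * M * P = mat_diag N f"
    using sig unfolding has_signature_def M_def[symmetric] f_def[abs_def] by auto
  obtain Q where Q: "P * Q = 1\<^sub>m N" "Q * P = 1\<^sub>m (dim_row Q)"
    using P(1,2) unfolding invertible_mat_def inverts_mat_def by auto
  have "dim_col Q = N" using arg_cong[OF Q(1), of dim_col] by simp
  moreover have "dim_row Q = N" using arg_cong[OF Q(2), of dim_col] P(1) by simp
  ultimately have Qc: "Q \<in> carrier_mat N N" by blast
  define x where "x u = vec N (\<lambda>j. real_of_int (\<gamma> u j))" for u
  have xc: "x u \<in> carrier_vec N" for u by (simp add: x_def)
  have PQ: "P *\<^sub>v (Q *\<^sub>v x u) = x u" for u
    using assoc_mult_mat_vec[OF P(1) Qc xc, of u] Q(1) xc[of u] by simp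
  define \<phi> where "\<phi> i u = (Q *\<^sub>v x u) $ i" for i u
  have "real_of_int (- chi u v) = (\<Sum>i<N. f i * (\<phi> i u * \<phi> i v))"
    if perp: "chi p u = 0" "chi p v = 0" for u v
  proof -
    obtain k where k: "u = (\<Sum>i<N. zscale (\<gamma> u i) (ws ! i)) + zscale k p"
      using dec[OF perp(1)] unfolding N_def by blast
    obtain l where l: "v = (\<Sum>j<N. zscale (\<gamma> v j) (ws ! j)) + zscale l p"
      using dec[OF perp(2)] unfolding N_def by blast
    have ws_perp: "chi p (ws ! i) = 0" "chi (ws ! i) p = 0" if "i < N" for i
      using ws(2)[of "ws ! i"] that len chi_point_commute[of "ws ! i"] by simp_all
    have "chi u v = chi (\<Sum>i<N. zscale (\<gamma> u i) (ws ! i)) v"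
      by (subst k) (simp add: perp(2))
    also have "\<dots> = (\<Sum>i<N. \<gamma> u i * chi (ws ! i) v)" by (simp add: chi_sum)
    also have "\<dots> = (\<Sum>i<N. \<gamma> u i * (\<Sum>j<N. \<gamma> v j * chi (ws ! i) (ws ! j)))"
    proof (intro sum.cong refl arg_cong2[of _ _ _ _ "(*)"])
      fix i assume "i \<in> {..<N}"
      then have "chi (ws ! i) (zscale l p) = 0" using ws_perp by simp
      then show "chi (ws ! i) v = (\<Sum>j<N. \<gamma> v j * chi (ws ! i) (ws ! j))"
        by (subst l) (simp add: chi_sum)
    qed
    finally have "real_of_int (- chi u v) =
        (\<Sum>i<N. \<gamma> u i * (\<Sum>j<N. real_of_int (- chi (ws ! i) (ws ! j)) * \<gamma> v j))"
      by (simp add: sum_negf mult.commute)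
    also have "\<dots> = x u \<bullet> (M *\<^sub>v x v)"
    proof -
      have M_entry: "M $$ (i, j) = real_of_int (- chi (ws ! i) (ws ! j))" if "i < N" "j < N" for i j
      proof -
        have "M $$ (i, j) = ns_form chi (Ds ! i) (Ds ! j)"
          using that by (simp add: M_def ns_gram_def N_def)
        also have "\<dots> = - chi (ws ! i) (ws ! j)"
          unfolding ws(1) using that len ws_perp by (simp add: ns_form_class)
        finally show ?thesis .
      qed
      have "(M *\<^sub>v x v) $ i = (\<Sum>j<N. real_of_int (- chi (ws ! i) (ws ! j)) * \<gamma> v j)" if "i < N" for i
      proof -
        have "(M *\<^sub>v x v) $ i = (\<Sum>j<N. M $$ (i, j) * \<gamma> v j)"
          using M that by (simp add: scalar_prod_def x_def atLeast0LessThan)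
        also have "\<dots> = (\<Sum>j<N. real_of_int (- chi (ws ! i) (ws ! j)) * \<gamma> v j)"
          using that by (intro sum.cong) (simp_all add: M_entry)
        finally show ?thesis .
      qed
      moreover have "x u \<bullet> (M *\<^sub>v x v) = (\<Sum>i<N. \<gamma> u i * (M *\<^sub>v x v) $ i)"
        using M by (simp add: scalar_prod_def x_def atLeast0LessThan)
      ultimately show ?thesis by simp
    qed
    also have "\<dots> = (P *\<^sub>v (Q *\<^sub>v x u)) \<bullet> (M *\<^sub>v (P *\<^sub>v (Q *\<^sub>v x v)))"
      using PQ by simp
    also have "\<dots> = (Q *\<^sub>v x u) \<bullet> (transpose_mat P *\<^sub>v (M *\<^sub>v (P *\<^sub>v (Q *\<^sub>v x v))))"
      using transpose_vec_mult_scalar[of "transpose_mat P" N N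
          "M *\<^sub>v (P *\<^sub>v (Q *\<^sub>v x v))" "Q *\<^sub>v x u"] P(1) Qc xc[of u] xc[of v] M
      by (simp del: index_mult_mat_vec)
    also have "transpose_mat P *\<^sub>v (M *\<^sub>v (P *\<^sub>v (Q *\<^sub>v x v))) = mat_diag N f *\<^sub>v (Q *\<^sub>v x v)"
      unfolding P(3)[symmetric] using P(1) Qc xc[of v] M
      by (simp add: assoc_mult_mat_vec[of _ N N _ N])
    also have "(Q *\<^sub>v x u) \<bullet> (mat_diag N f *\<^sub>v (Q *\<^sub>v x v)) = (\<Sum>i<N. f i * (\<phi> i u * \<phi> i v))"
    proof -
      have "(mat_diag N f *\<^sub>v y) $ i = f i * y $ i" if "i < N" "y \<in> carrier_vec N" for i y
      proof -
        have "(mat_diag N f *\<^sub>v y) $ i = (\<Sum>j<N. (if i = j then f j else 0) * y $ j)"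
          using that by (simp add: mat_diag_def scalar_prod_def atLeast0LessThan)
        also have "\<dots> = (\<Sum>j<N. if j = i then f i * y $ i else 0)"
          by (rule sum.cong) auto
        finally have "(mat_diag N f *\<^sub>v y) $ i = (\<Sum>j<N. if j = i then f i * y $ i else 0)" .
        then show ?thesis using that by simp
      qed
      then have diag: "(mat_diag N f *\<^sub>v (Q *\<^sub>v x v)) $ i = f i * (Q *\<^sub>v x v) $ i" if "i < N" for i
        using that Qc xc[of v] mult_mat_vec_carrier by blast
      have "(Q *\<^sub>v x u) \<bullet> (mat_diag N f *\<^sub>v (Q *\<^sub>v x v)) =
          (\<Sum>i<N. (Q *\<^sub>v x u) $ i * (mat_diag N f *\<^sub>v (Q *\<^sub>v x v)) $ i)"
        by (simp only: scalar_prod_def) (simp add: mat_diag_def atLeast0LessThan del: index_mult_mat_vec)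
      also have "\<dots> = (\<Sum>i<N. f i * (\<phi> i u * \<phi> i v))"
        by (intro sum.cong refl) (simp add: diag \<phi>_def mult.left_commute del: index_mult_mat_vec)
      finally show ?thesis .
    qed
    finally show ?thesis .
  qed
  then show ?thesis unfolding f_def N_def by (rule that)
qed

lemma signature_imp_hodge_index:
  assumes Ds: "ns_basis chi p Ds" and sig: "has_signature (ns_gram chi Ds) 1 b"
    and perp: "chi p u = 0" "chi p v = 0" "chi p w = 0"
    and signs: "chi u u < 0" "chi u v = 0" "chi v v \<le> 0"
  shows "chi v w = 0"
proof -
  obtain \<phi> where \<phi>: "\<And>u v. chi p u = 0 \<Longrightarrow> chi p v = 0 \<Longrightarrow> real_of_int (- chi u v) =
       (\<Sum>i<length Ds. (if i < 1 then 1 else if i < 1 + b then - 1 else 0) * (\<phi> i u * \<phi> i v))"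
    using signature_imp_diagonal[OF Ds sig] by blast
  have "1 + b \<le> length Ds" using sig by (simp add: has_signature_def ns_gram_def)
  then have pos: "length Ds > 0" by linarith
  define e :: "nat \<Rightarrow> real" where "e i = (if i < 1 + b then 1 else 0)" for i
  let ?I = "{1..<length Ds}"
  have form: "real_of_int (- chi s t) = \<phi> 0 s * \<phi> 0 t - (\<Sum>i\<in>?I. e i * (\<phi> i s * \<phi> i t))"
    if "chi p s = 0" "chi p t = 0" for s t
  proof -
    have "{..<length Ds} = insert 0 ?I" using pos by auto
    then have "real_of_int (- chi s t) = \<phi> 0 s * \<phi> 0 t +
      (\<Sum>i\<in>?I. (if i < 1 then 1 else if i < 1 + b then - 1 else 0) * (\<phi> i s * \<phi> i t))"
      unfolding \<phi>[OF that] by simp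
    also have "(\<Sum>i\<in>?I. (if i < 1 then 1 else if i < 1 + b then - 1 else 0) * (\<phi> i s * \<phi> i t)) =
        (\<Sum>i\<in>?I. - (e i * (\<phi> i s * \<phi> i t)))"
      by (intro sum.cong) (auto simp: e_def)
    finally show ?thesis by (simp add: sum_negf)
  qed
  have "\<phi> 0 v * \<phi> 0 w = (\<Sum>i\<in>?I. e i * (\<phi> i v * \<phi> i w))"
  proof (rule lorentzian_orthogonal[of ?I e "\<lambda>i. \<phi> i u" "\<lambda>i. \<phi> i v" "\<lambda>i. \<phi> i w"])
    have "real_of_int (- chi u u) > 0" "real_of_int (- chi u v) = 0" "real_of_int (- chi v v) \<ge> 0"
      using signs by simp_all
    then show "\<phi> 0 u * \<phi> 0 u > (\<Sum>i\<in>?I. e i * (\<phi> i u * \<phi> i u))"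
      "\<phi> 0 u * \<phi> 0 v = (\<Sum>i\<in>?I. e i * (\<phi> i u * \<phi> i v))"
      "\<phi> 0 v * \<phi> 0 v \<ge> (\<Sum>i\<in>?I. e i * (\<phi> i v * \<phi> i v))"
      unfolding form[OF perp(1) perp(1)] form[OF perp(1) perp(2)] form[OF perp(2) perp(2)]
      by linarith+
  qed (simp_all add: e_def)
  then have "real_of_int (- chi v w) = 0" unfolding form[OF perp(2) perp(3)] by simp
  then show ?thesis by simp
qed

end

lemma geometric_defect_zero_imp_geometric_surface:
  assumes geo: "geometric_pseudolattice chi p" and defect: "defect chi p = 0"
    and es: "exceptional_basis chi es"
  obtains kap where "geometric_surface chi p kap" "chi kap kap = int (length es) - 12"
proof -
  interpret surface_like chi p using geo by (simp add: geometric_pseudolattice_def)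
  obtain v1 where v1: "chi p v1 = 1" using exists_rank_one[OF es] .
  obtain kap where "canonical_surface chi p kap" using exists_canonical_surface[OF es] .
  then interpret canonical_surface chi p kap .
  obtain Ds where Ds: "ns_basis chi p Ds" and sig: "has_signature (ns_gram chi Ds) 1 (ns_rank chi p - 1)"
    using geo unfolding geometric_pseudolattice_def ns_has_signature_def by blast
  obtain K where K: "K \<in> NS chi p" "canonical_class chi p = ns_embed chi p K"
      "\<And>D. D \<in> NS chi p \<Longrightarrow> ns_form chi D D mod 2 = ns_form chi K D mod 2"
    using geo unfolding geometric_pseudolattice_def by blast
  have "K = ns_class p kap"
  proof -
    have "(K, 1) \<in> ns_frac chi p K 1" using K(1) by (simp add: ns_frac_def)
    also have "ns_frac chi p K 1 = ns_frac chi p (ns_class p kap) 1"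
      using K(2) canonical_class_eq[OF v1] by (simp only: ns_embed_def)
    finally obtain e where "K = ns_class p e" "ns_class p (zscale 1 kap) = ns_class p (zscale 1 e)"
      unfolding in_ns_frac_class_iff by blast
    then show ?thesis by simp
  qed
  have par: "even (chi v v - chi kap v)" if v: "chi p v = 0" for v
  proof -
    have "ns_class p v \<in> NS chi p" using v by (simp add: NS_def point_perp_def)
    from K(3)[OF this] have "(- chi v v) mod 2 = (- chi kap v) mod 2"
      using v kap_perp by (simp add: \<open>K = ns_class p kap\<close> ns_form_class)
    then show ?thesis by presburger
  qed
  have "geometric_surface chi p kap"
  proof unfold_locales
    show "chi v w = 0" if "chi p u = 0" "chi p v = 0" "chi p w = 0" "chi u u < 0" "chi u v = 0"
      "chi v v \<le> 0" for u v w
      using that by (rule signature_imp_hodge_index[OF Ds sig])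
    show "even (chi v v - chi kap v)" if "chi p v = 0" for v using that by (rule par)
  qed
  moreover have "nsq_form chi (canonical_class chi p) (canonical_class chi p) = of_int (- chi kap kap)"
    unfolding canonical_class_eq[OF v1] ns_embed_def
    using nsq_form_frac[OF kap_perp kap_perp, of 1 1] by simp
  then have "(of_int (- chi kap kap + int (ns_rank chi p) - 10) :: rat) = 0"
    using defect by (simp add: defect_def)
  then have "- chi kap kap + int (ns_rank chi p) - 10 = 0" by (simp only: of_int_eq_0_iff)
  then have "chi kap kap = int (length es) - 12" using ns_rank_eq(2)[OF es Ds] by simp
  ultimately show ?thesis by (rule that)
qed

section \<open>Mutations\<close>

lemma mutation_append_left: "mutation chi xs ys \<Longrightarrow> mutation chi (us @ xs) (us @ ys)"
proof (induction rule: mutation.induct)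
  case (left xs e f ys)
  show ?case using mutation.left[of chi "us @ xs" e f ys] by simp
next
  case (right xs e f ys)
  show ?case using mutation.right[of chi "us @ xs" e f ys] by simp
qed

lemma mutations_append_left:
  "(mutation chi)\<^sup>*\<^sup>* xs ys \<Longrightarrow> (mutation chi)\<^sup>*\<^sup>* (us @ xs) (us @ ys)"
proof (induction rule: rtranclp_induct)
  case (step ys zs)
  show ?case
    using step.IH mutation_append_left[OF step.hyps(2)] by (rule rtranclp.rtrancl_into_rtrancl)
qed simp

lemma mutations_Cons: "(mutation chi)\<^sup>*\<^sup>* xs ys \<Longrightarrow> (mutation chi)\<^sup>*\<^sup>* (u # xs) (u # ys)"
  using mutations_append_left[of chi xs ys "[u]"] by simp

lemma left_mutation: "mutation chi (e # f # ys) (left_mut chi e f # e # ys)"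
  using mutation.left[of chi "[]" e f ys] by simp

lemma right_mutation: "mutation chi (e # f # ys) (f # right_mut chi f e # ys)"
  using mutation.right[of chi "[]" e f ys] by simp

lemma mutation_length: "mutation chi es fs \<Longrightarrow> length fs = length es"
  by (induction rule: mutation.induct) simp_all

lemma mutations_length: "(mutation chi)\<^sup>*\<^sup>* es fs \<Longrightarrow> length fs = length es"
  by (induction rule: rtranclp_induct) (auto dest: mutation_length)

lemma list_all2_in_set_left:
  assumes "list_all2 P xs ys" "x \<in> set xs"
  shows "\<exists>y\<in>set ys. P x y"
  using assms by (induction rule: list_all2_induct) auto

lemma list_all2_in_set_right:
  assumes "list_all2 P xs ys" "y \<in> set ys"
  shows "\<exists>x\<in>set xs. P x y"
  using assms by (induction rule: list_all2_induct) auto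

definition rank_norm :: "('a::ab_group_add \<Rightarrow> 'a \<Rightarrow> int) \<Rightarrow> 'a \<Rightarrow> 'a list \<Rightarrow> int" where
  "rank_norm chi p es = (\<Sum>e\<leftarrow>es. (chi p e)\<^sup>2)"

lemma rank_norm_simps [simp]:
  "rank_norm chi p [] = 0" "rank_norm chi p (e # es) = (chi p e)\<^sup>2 + rank_norm chi p es"
  "rank_norm chi p (xs @ ys) = rank_norm chi p xs + rank_norm chi p ys"
  by (simp_all add: rank_norm_def)

lemma rank_norm_nonneg: "rank_norm chi p es \<ge> 0"
  by (induction es) simp_all

lemma rank_norm_cong: "map (chi p) xs = map (chi p) ys \<Longrightarrow> rank_norm chi p xs = rank_norm chi p ys"
proof -
  have "rank_norm chi p es = (\<Sum>r\<leftarrow>map (chi p) es. r\<^sup>2)" for es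
    by (simp add: rank_norm_def comp_def)
  then show "map (chi p) xs = map (chi p) ys \<Longrightarrow> ?thesis" by (simp only:)
qed

context pseudolattice
begin

lemma mutation_exceptional_seq:
  assumes "mutation chi es fs" "exceptional_seq chi es"
  shows "exceptional_seq chi fs"
  using assms
proof (induction rule: mutation.induct)
  case (left xs e f ys)
  then show ?case
    by (auto simp: exceptional_seq_append exceptional_seq_Cons left_mut_def)
next
  case (right xs e f ys)
  then show ?case
    by (auto simp: exceptional_seq_append exceptional_seq_Cons right_mut_def)
qed

lemma mutation_span:
  assumes "mutation chi es fs"
  shows "zmod.span (set es) \<subseteq> zmod.span (set fs)"
  using assms
proof (induction rule: mutation.induct)
  case (left xs e f ys)
  let ?S = "zmod.span (set (xs @ [left_mut chi e f, e] @ ys))"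
  have "left_mut chi e f + zscale (chi e f) e \<in> ?S"
    by (intro zmod.span_add zmod.span_scale) (auto intro: zmod.span_base)
  then have "f \<in> ?S" by (simp add: left_mut_def)
  then have "set (xs @ [e, f] @ ys) \<subseteq> ?S" by (auto intro: zmod.span_base)
  then show ?case by (rule zmod.span_minimal) (rule zmod.subspace_span)
next
  case (right xs e f ys)
  let ?S = "zmod.span (set (xs @ [f, right_mut chi f e] @ ys))"
  have "right_mut chi f e + zscale (chi e f) f \<in> ?S"
    by (intro zmod.span_add zmod.span_scale) (auto intro: zmod.span_base)
  then have "e \<in> ?S" by (simp add: right_mut_def)
  then have "set (xs @ [e, f] @ ys) \<subseteq> ?S" by (auto intro: zmod.span_base)
  then show ?case by (rule zmod.span_minimal) (rule zmod.subspace_span)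
qed

lemma mutations_exceptional_basis:
  assumes "(mutation chi)\<^sup>*\<^sup>* es fs" "exceptional_basis chi es"
  shows "exceptional_basis chi fs"
  using assms
proof (induction rule: rtranclp_induct)
  case (step fs gs)
  then show ?case
    using mutation_exceptional_seq[of fs gs] mutation_span[of fs gs]
    by (auto simp: exceptional_basis_iff)
qed

text \<open>Mutating an element of rank \<open>0\<close> to the right replaces its neighbours by elements of the
  same rank, so it can be moved to the end.\<close>

lemma mutations_move_zero_rank:
  assumes "chi p z = 0"
  shows "\<exists>ys'. (mutation chi)\<^sup>*\<^sup>* (z # ys @ ws) (ys' @ z # ws) \<and> map (chi p) ys' = map (chi p) ys"
proof (induction ys)
  case Nil
  show ?case by (rule exI[of _ "[]"]) simp
next
  case (Cons y ys)
  then obtain ys' where ys': "(mutation chi)\<^sup>*\<^sup>* (z # ys @ ws) (ys' @ z # ws)"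
    "map (chi p) ys' = map (chi p) ys" by blast
  have "(mutation chi)\<^sup>*\<^sup>* (z # (y # ys) @ ws) ((left_mut chi z y # ys') @ z # ws)"
    using converse_rtranclp_into_rtranclp[of "mutation chi", OF _ mutations_Cons[OF ys'(1)]]
      left_mutation[of chi z y "ys @ ws"] by simp
  moreover have "map (chi p) (left_mut chi z y # ys') = map (chi p) (y # ys)"
    using assms ys'(2) by (simp add: left_mut_def)
  ultimately show ?case by blast
qed

lemma mutations_zero_ranks_last:
  "\<exists>fs zs. (mutation chi)\<^sup>*\<^sup>* es (fs @ zs) \<and> (\<forall>f\<in>set fs. chi p f \<noteq> 0) \<and>
     (\<forall>z\<in>set zs. chi p z = 0) \<and> rank_norm chi p (fs @ zs) = rank_norm chi p es"
proof (induction es)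
  case Nil
  show ?case by (intro exI[of _ "[]"]) simp
next
  case (Cons e es)
  then obtain fs zs where fs: "(mutation chi)\<^sup>*\<^sup>* es (fs @ zs)" "\<forall>f\<in>set fs. chi p f \<noteq> 0"
    "\<forall>z\<in>set zs. chi p z = 0" "rank_norm chi p (fs @ zs) = rank_norm chi p es" by blast
  have step: "(mutation chi)\<^sup>*\<^sup>* (e # es) (e # fs @ zs)" by (rule mutations_Cons) (rule fs(1))
  show ?case
  proof (cases "chi p e = 0")
    case False
    then show ?thesis using step fs by (intro exI[of _ "e # fs"] exI[of _ zs]) auto
  next
    case True
    from mutations_move_zero_rank[OF this, of fs zs] obtain fs' where
      fs': "(mutation chi)\<^sup>*\<^sup>* (e # fs @ zs) (fs' @ e # zs)" "map (chi p) fs' = map (chi p) fs" by blast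
    have "\<forall>f\<in>set fs'. chi p f \<noteq> 0"
    proof
      fix f assume "f \<in> set fs'"
      then have "chi p f \<in> set (map (chi p) fs')" by simp
      then show "chi p f \<noteq> 0" unfolding fs'(2) using fs(2) by auto
    qed
    moreover have "rank_norm chi p (fs' @ e # zs) = rank_norm chi p (e # es)"
      using fs(4) rank_norm_cong[of chi p fs' fs] fs'(2) True by simp
    moreover have "(mutation chi)\<^sup>*\<^sup>* (e # es) (fs' @ e # zs)" using step fs'(1) by (rule rtranclp_trans)
    ultimately show ?thesis
      using fs(3) True by (intro exI[of _ fs'] exI[of _ "e # zs"]) simp
  qed
qed

text \<open>One step of the helix: the first element is mutated to the right through \<open>fs\<close>.\<close>

lemma mutations_move_right:
  "\<exists>g. (mutation chi)\<^sup>*\<^sup>* (e # fs @ ws) (fs @ g # ws) \<and> g - e \<in> zmod.span (set fs)"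
proof (induction fs arbitrary: e)
  case Nil
  show ?case by (intro exI[of _ e]) simp
next
  case (Cons f fs)
  obtain g where g: "(mutation chi)\<^sup>*\<^sup>* (right_mut chi f e # fs @ ws) (fs @ g # ws)"
    "g - right_mut chi f e \<in> zmod.span (set fs)" using Cons.IH by blast
  have "(mutation chi)\<^sup>*\<^sup>* (e # (f # fs) @ ws) ((f # fs) @ g # ws)"
    using converse_rtranclp_into_rtranclp[of "mutation chi", OF _ mutations_Cons[OF g(1)]]
      right_mutation[of chi e f "fs @ ws"] by simp
  moreover have "(g - right_mut chi f e) - zscale (chi e f) f \<in> zmod.span (set (f # fs))"
  proof (rule zmod.span_diff)
    show "g - right_mut chi f e \<in> zmod.span (set (f # fs))"
      using g(2) zmod.span_mono[of "set fs" "set (f # fs)"] by auto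
    show "zscale (chi e f) f \<in> zmod.span (set (f # fs))"
      by (intro zmod.span_scale zmod.span_base) simp
  qed
  then have "g - e \<in> zmod.span (set (f # fs))" by (simp add: right_mut_def)
  ultimately show ?case by blast
qed

lemma exceptional_basis_signs:
  assumes signs: "equal_up_to_signs fs gs" and fs: "exceptional_basis chi fs"
  shows "exceptional_basis chi gs"
proof -
  have pm: "list_all2 (\<lambda>f g. g = f \<or> g = - f) fs gs" using signs by (simp add: equal_up_to_signs_def)
  have "exceptional_seq chi gs"
    if "list_all2 (\<lambda>f g. g = f \<or> g = - f) fs gs" "exceptional_seq chi fs"
    using that
  proof (induction rule: list_all2_induct)
    case (Cons f fs g gs)
    have "chi h g = 0" if h: "h \<in> set gs" for h
    proof -
      obtain h' where "h' \<in> set fs" "h = h' \<or> h = - h'"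
        using list_all2_in_set_right[OF Cons.hyps(2) h] by blast
      then show ?thesis using Cons.prems Cons.hyps(1) by (auto simp: exceptional_seq_Cons)
    qed
    then show ?case using Cons by (auto simp: exceptional_seq_Cons)
  qed simp
  moreover have "set fs \<subseteq> zmod.span (set gs)"
  proof
    fix f assume "f \<in> set fs"
    then obtain g where "g \<in> set gs" "g = f \<or> g = - f"
      using list_all2_in_set_left[OF pm] by blast
    then show "f \<in> zmod.span (set gs)"
      using zmod.span_base[of g "set gs"] zmod.span_neg[of g "set gs"] by auto
  qed
  then have "zmod.span (set fs) \<subseteq> zmod.span (set gs)"
    by (rule zmod.span_minimal) (rule zmod.subspace_span)
  ultimately show ?thesis using pm fs by (auto simp: exceptional_basis_iff)
qed

end

section \<open>Cyclic systems\<close>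

text \<open>A property of residues that passes from each residue to the next holds for all of them once it
  holds for one.\<close>

lemma periodic_closed_imp_all:
  fixes P :: "int \<Rightarrow> bool"
  assumes m: "m > 0" and per: "\<And>i. P (i + int m) \<longleftrightarrow> P i" and step: "\<And>i. P i \<Longrightarrow> P (i + 1)" and j: "P j"
  shows "P k"
proof -
  have up: "P (j + int n)" for n
  proof (induction n)
    case (Suc n)
    then show ?case using step[of "j + int n"] by (simp add: ac_simps)
  qed (use j in simp)
  have down: "P (k + int q * int m) \<longleftrightarrow> P k" for q
  proof (induction q)
    case (Suc q)
    then show ?case using per[of "k + int q * int m"] by (simp add: algebra_simps)
  qed simp
  have "k - j + \<bar>k - j\<bar> * int m \<ge> 0"
    using m mult_left_mono[of 1 "int m" "\<bar>k - j\<bar>"] by simp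
  then have "j + int (nat (k - j + \<bar>k - j\<bar> * int m)) = k + int (nat \<bar>k - j\<bar>) * int m" by simp
  then show ?thesis using up down by metis
qed

text \<open>The intersection numbers of a cycle of classes \<open>D i\<close>, indexed by integers modulo \<open>m\<close>: the square
  of \<open>D i\<close> is \<open>a i\<close>, and \<open>D (i - 1)\<close> meets \<open>D i\<close> in \<open>S i\<close>. As \<open>D i\<close> meets the sum of the cycle in
  \<open>S i + a i + S (i + 1)\<close>, the first alternative of the dichotomy says that this number is at most
  \<open>0\<close>.\<close>

locale cyclic_system =
  fixes m :: nat and S a :: "int \<Rightarrow> int"
  assumes m_ge_3: "m \<ge> 3"
    and S_pos: "S i > 0"
    and S_periodic: "S (i + int m) = S i"
    and a_periodic: "a (i + int m) = a i"
    and dichotomy: "a i \<le> - (S i + S (i + 1)) \<or> \<bar>S i - S (i + 1)\<bar> \<le> a i"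
begin

text \<open>Coefficients of a combination of the \<open>D i\<close> that is orthogonal to all \<open>D i\<close>. For a toric surface
  these are the values of a linear function on the rays of the fan.\<close>

definition relation :: "(int \<Rightarrow> int) \<Rightarrow> bool" where
  "relation c \<longleftrightarrow> (\<forall>i. c (i + int m) = c i) \<and>
     (\<forall>i. S i * c (i - 1) + a i * c i + S (i + 1) * c (i + 1) = 0)"

lemma relation_periodic: "relation c \<Longrightarrow> c (i + int m) = c i"
  by (simp add: relation_def)

lemma relation_eq: "relation c \<Longrightarrow> S i * c (i - 1) + a i * c i + S (i + 1) * c (i + 1) = 0"
  by (simp add: relation_def)

lemma relation_lincomb:
  assumes "relation x" "relation y"
  shows "relation (\<lambda>i. s * x i + t * y i)"
proof -
  have "S i * (s * x (i - 1) + t * y (i - 1)) + a i * (s * x i + t * y i) +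
      S (i + 1) * (s * x (i + 1) + t * y (i + 1)) =
    s * (S i * x (i - 1) + a i * x i + S (i + 1) * x (i + 1)) +
    t * (S i * y (i - 1) + a i * y i + S (i + 1) * y (i + 1))" for i
    by (simp add: algebra_simps)
  then show ?thesis using assms by (simp add: relation_def)
qed

lemma periodic_mod:
  assumes "\<And>i. f (i + int m) = (f i :: 'b)"
  shows "f (i mod int m) = f i"
proof -
  have "f (k + int n * int m) = f k" for k n
  proof (induction n)
    case (Suc n)
    then show ?case using assms[of "k + int n * int m"] by (simp add: algebra_simps)
  qed simp
  note shift = this
  show ?thesis
  proof (cases "i div int m \<ge> 0")
    case True
    then show ?thesis
      using shift[of "i mod int m" "nat (i div int m)"] by simp
  next
    case False
    then have "i + int (nat (- (i div int m))) * int m = i - i div int m * int m" by simp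
    also have "\<dots> = i mod int m" by (rule minus_div_mult_eq_mod)
    finally show ?thesis using shift[of i "nat (- (i div int m))"] by simp
  qed
qed

lemma periodic_cong:
  assumes "\<And>i. f (i + int m) = (f i :: 'b)" and "(i - k) mod int m = r mod int m"
  shows "f i = f (k + r)"
proof -
  have "i mod int m = (k + r) mod int m"
    using assms(2) by (metis add.commute diff_add_cancel mod_add_left_eq)
  then show ?thesis using periodic_mod[of f i, OF assms(1)] periodic_mod[of f "k + r", OF assms(1)] by simp
qed

text \<open>Where \<open>a i\<close> is negative, \<open>c i\<close> is a weighted average of its two neighbours times a positive
  factor at most \<open>1\<close>. So a positive maximum spreads to the neighbours.\<close>

lemma max_principle:
  assumes c: "relation c" and pos: "c j > 0" and neg: "\<And>i. c i > 0 \<Longrightarrow> a i < 0"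
  shows "c k > 0"
proof -
  define M where "M = Max (c ` {0..<int m})"
  have le: "c i \<le> M" for i
  proof -
    have "c (i mod int m) \<le> M" unfolding M_def using m_ge_3 by (intro Max_ge) auto
    then show ?thesis using periodic_mod[of c i] relation_periodic[OF c] by simp
  qed
  have "M \<in> c ` {0..<int m}" unfolding M_def using m_ge_3 by (intro Max_in) auto
  then obtain i0 where i0: "c i0 = M" by auto
  have M: "M > 0" using pos le[of j] by linarith
  have "c (i + 1) = M" if i: "c i = M" for i
  proof -
    have "a i < 0" using neg[of i] i M by simp
    then have "a i \<le> - (S i + S (i + 1))" using dichotomy[of i] by linarith
    then have "a i * M \<le> - (S i + S (i + 1)) * M" using M by (intro mult_right_mono) simp_all
    moreover have "S i * c (i - 1) \<le> S i * M" using le S_pos[of i] by (intro mult_left_mono) simp_all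
    ultimately have "S (i + 1) * M \<le> S (i + 1) * c (i + 1)"
      using relation_eq[OF c, of i] i by (simp add: algebra_simps)
    then show ?thesis using S_pos[of "i + 1"] le[of "i + 1"] by simp
  qed
  then have "c k = M"
    using periodic_closed_imp_all[of m "\<lambda>i. c i = M" i0 k] i0 m_ge_3 relation_periodic[OF c] by simp
  then show ?thesis using M by simp
qed

text \<open>\<open>S (i + 1) * (x i * y (i + 1) - x (i + 1) * y i)\<close> is a discrete Wronskian and does not depend
  on \<open>i\<close>.\<close>

lemma wronskian_nonzero:
  assumes x: "relation x" and y: "relation y" and j: "x j * y (j + 1) \<noteq> x (j + 1) * y j"
  shows "x k * y (k + 1) \<noteq> x (k + 1) * y k"
proof (rule periodic_closed_imp_all[of m "\<lambda>k. x k * y (k + 1) \<noteq> x (k + 1) * y k" j])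
  show "m > 0" using m_ge_3 by simp
  have "x (i + int m + 1) = x (i + 1)" "y (i + int m + 1) = y (i + 1)" for i
    using relation_periodic[OF x, of "i + 1"] relation_periodic[OF y, of "i + 1"]
    by (simp_all add: algebra_simps)
  then show "x (i + int m) * y (i + int m + 1) \<noteq> x (i + int m + 1) * y (i + int m) \<longleftrightarrow>
      x i * y (i + 1) \<noteq> x (i + 1) * y i" for i
    using relation_periodic[OF x] relation_periodic[OF y] by simp
  fix i assume i: "x i * y (i + 1) \<noteq> x (i + 1) * y i"
  show "x (i + 1) * y (i + 1 + 1) \<noteq> x (i + 1 + 1) * y (i + 1)"
  proof
    assume eq: "x (i + 1) * y (i + 1 + 1) = x (i + 1 + 1) * y (i + 1)"
    have "S (i + 1) * (x i * y (i + 1) - x (i + 1) * y i) =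
        y (i + 1) * (S (i + 1) * x (i + 1 - 1) + a (i + 1) * x (i + 1) + S (i + 1 + 1) * x (i + 1 + 1))
        - x (i + 1) * (S (i + 1) * y (i + 1 - 1) + a (i + 1) * y (i + 1) + S (i + 1 + 1) * y (i + 1 + 1))
        + S (i + 1 + 1) * (x (i + 1) * y (i + 1 + 1) - x (i + 1 + 1) * y (i + 1))"
      by (simp add: algebra_simps)
    also have "\<dots> = 0" unfolding relation_eq[OF x] relation_eq[OF y] eq by simp
    finally show False using i S_pos[of "i + 1"] by simp
  qed
qed (rule j)

end

locale cyclic_system_with_relations = cyclic_system +
  fixes x y :: "int \<Rightarrow> int"
  assumes x: "relation x" and y: "relation y"
    and wronskian: "x k * y (k + 1) \<noteq> x (k + 1) * y k"
begin

text \<open>Suppose that all \<open>a i\<close> outside the positions \<open>k\<close> and \<open>k + 1\<close> are negative. Some relation takes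
  one and the same negative value at these two positions, by the Wronskian; by the maximum principle
  it is nowhere positive, so its equation fails at a position where \<open>a\<close> is nonnegative. If there is no
  such position, a relation vanishing only at \<open>k\<close> of the two contradicts the maximum principle.\<close>

lemma nonneg_outside_pair: "\<exists>i. a i \<ge> 0 \<and> (i - k) mod int m \<noteq> 0 \<and> (i - k) mod int m \<noteq> 1"
proof (rule ccontr)
  assume none: "\<nexists>i. a i \<ge> 0 \<and> (i - k) mod int m \<noteq> 0 \<and> (i - k) mod int m \<noteq> 1"
  have pair: "f i = f k \<or> f i = f (k + 1)"
    if f: "\<And>i. f (i + int m) = (f i :: int)" and i: "a i \<ge> 0" for f i
  proof -
    have "(i - k) mod int m = 0 mod int m \<or> (i - k) mod int m = 1 mod int m"
      using none i m_ge_3 by auto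
    then show ?thesis using periodic_cong[of f i k 0, OF f] periodic_cong[of f i k 1, OF f] by auto
  qed
  define w where "w = x k * y (k + 1) - x (k + 1) * y k"
  \<comment> \<open>The sign makes the relations below positive, respectively negative, where required.\<close>
  define \<sigma> where "\<sigma> = - sgn w"
  have w: "w \<noteq> 0" using wronskian[of k] by (simp add: w_def)
  have \<sigma>w: "\<sigma> * w = - \<bar>w\<bar>" by (simp add: \<sigma>_def abs_sgn mult.commute)
  show False
  proof (cases "\<exists>i. a i \<ge> 0")
    case False
    define c where "c i = (\<sigma> * y k) * x i + (- \<sigma> * x k) * y i" for i
    have c: "relation c" unfolding c_def[abs_def] by (rule relation_lincomb[OF x y])
    have "c (k + 1) = - (\<sigma> * w)" by (simp add: c_def w_def algebra_simps)
    then have "c (k + 1) > 0" using \<sigma>w w by simp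
    moreover have "a i < 0" for i using False by (simp add: not_le)
    ultimately have "c k > 0" using max_principle[OF c] by blast
    then show False by (simp add: c_def)
  next
    case True
    define c where "c i = (\<sigma> * (y (k + 1) - y k)) * x i + (\<sigma> * (x k - x (k + 1))) * y i" for i
    have c: "relation c" unfolding c_def[abs_def] by (rule relation_lincomb[OF x y])
    have "c k = \<sigma> * w" "c (k + 1) = \<sigma> * w" by (simp_all add: c_def w_def algebra_simps)
    then have ck: "c k < 0" "c (k + 1) < 0" using \<sigma>w w by simp_all
    have le: "c i \<le> 0" for i
    proof (rule ccontr)
      assume "\<not> c i \<le> 0"
      moreover have "a j < 0" if "c j > 0" for j
      proof (rule ccontr)
        assume "\<not> a j < 0"
        then have "c j = c k \<or> c j = c (k + 1)"
          using pair[of c j] relation_periodic[OF c] by simp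
        then show False using that ck by auto
      qed
      ultimately have "c k > 0" using max_principle[OF c, of i k] by simp
      then show False using ck by simp
    qed
    obtain i where i: "a i \<ge> 0" using True by blast
    then have "a i = a k \<or> a i = a (k + 1)" using pair[of a i] a_periodic by simp
    then consider "a k \<ge> 0" | "a (k + 1) \<ge> 0" using i by auto
    then show False
    proof cases
      case 1
      have "S k * c (k - 1) \<le> 0" using S_pos[of k] le by (simp add: mult_nonneg_nonpos)
      moreover have "a k * c k \<le> 0" using 1 le by (simp add: mult_nonneg_nonpos)
      moreover have "S (k + 1) * c (k + 1) < 0" using S_pos ck by (simp add: mult_pos_neg)
      ultimately show False using relation_eq[OF c, of k] by linarith
    next
      case 2
      have "S (k + 1) * c (k + 1 - 1) < 0" using S_pos ck by (simp add: mult_pos_neg)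
      moreover have "a (k + 1) * c (k + 1) \<le> 0" using 2 le by (simp add: mult_nonneg_nonpos)
      moreover have "S (k + 1 + 1) * c (k + 1 + 1) \<le> 0"
        using S_pos[of "k + 1 + 1"] le by (simp add: mult_nonneg_nonpos)
      ultimately show False using relation_eq[OF c, of "k + 1"] by linarith
    qed
  qed
qed

lemma exists_nonadjacent_nonneg:
  assumes m: "m \<ge> 4"
  obtains i j where "a i \<ge> 0" "a j \<ge> 0" "(j - i) mod int m \<ge> 2" "(j - i) mod int m \<le> int m - 2"
proof -
  obtain k where k: "a k \<ge> 0" using nonneg_outside_pair by blast
  obtain i where i: "a i \<ge> 0" "(i - k) mod int m \<noteq> 0" "(i - k) mod int m \<noteq> 1"
    using nonneg_outside_pair by blast
  obtain j where j: "a j \<ge> 0" "(j - (k - 1)) mod int m \<noteq> 0" "(j - (k - 1)) mod int m \<noteq> 1"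
    using nonneg_outside_pair by blast
  have range: "0 \<le> t mod int m" "t mod int m < int m" for t using m by simp_all
  show ?thesis
  proof (cases "(i - k) mod int m = int m - 1")
    case False
    then show ?thesis using that[of k i] k i range[of "i - k"] by linarith
  next
    case True
    show ?thesis
    proof (cases "(j - (k - 1)) mod int m = 2")
      case False
      have "(j - k) mod int m = ((j - (k - 1)) mod int m - 1) mod int m"
        by (simp add: mod_diff_left_eq)
      also have "\<dots> = (j - (k - 1)) mod int m - 1"
        using j range[of "j - (k - 1)"] by (intro mod_pos_pos_trivial) linarith+
      finally show ?thesis using that[of k j] k j False range[of "j - (k - 1)"] by linarith
    next
      case j2: True
      have "(j - i) mod int m = ((j - (k - 1)) - (i - k) - 1) mod int m" by simp
      also have "\<dots> = ((j - (k - 1)) mod int m - (i - k) mod int m - 1) mod int m"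
        by (metis mod_diff_eq mod_diff_left_eq)
      also have "\<dots> = (2 + - 1 * int m) mod int m" unfolding j2 True by (simp add: algebra_simps)
      also have "\<dots> = 2" unfolding mod_mult_self1 using m by simp
      finally show ?thesis using that[of i j] i(1) j(1) m by simp
    qed
  qed
qed

text \<open>The equations of a relation at \<open>i\<close> and \<open>i + 1\<close> involve the same three values; eliminating one of
  them leaves a single equation that holds on a space of dimension \<open>2\<close>, hence is trivial.\<close>

lemma triangle_self_intersection:
  assumes m: "m = 3"
  shows "a i * S (i + 2) = S i * S (i + 1)"
proof -
  have eq: "(a i * S (i + 2) - S i * S (i + 1)) * c i + (S (i + 1) * S (i + 2) - S i * a (i + 1)) * c (i + 1) = 0"
    if c: "relation c" for c
  proof -
    have "c (i + 2) = c (i - 1)" using relation_periodic[OF c, of "i - 1"] m by (simp add: ac_simps)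
    then have "(a i * S (i + 2) - S i * S (i + 1)) * c i + (S (i + 1) * S (i + 2) - S i * a (i + 1)) * c (i + 1)
      = S (i + 2) * (S i * c (i - 1) + a i * c i + S (i + 1) * c (i + 1))
        - S i * (S (i + 1) * c (i + 1 - 1) + a (i + 1) * c (i + 1) + S (i + 1 + 1) * c (i + 1 + 1))"
      by (simp add: algebra_simps)
    then show ?thesis unfolding relation_eq[OF c] by simp
  qed
  define A B where "A = a i * S (i + 2) - S i * S (i + 1)" and "B = S (i + 1) * S (i + 2) - S i * a (i + 1)"
  have "A * x i + B * x (i + 1) = 0" "A * y i + B * y (i + 1) = 0"
    using eq[OF x] eq[OF y] by (simp_all add: A_def B_def)
  have "A * (x i * y (i + 1) - x (i + 1) * y i) = 0"
  proof -
    have "A * (x i * y (i + 1) - x (i + 1) * y i) =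
        y (i + 1) * (A * x i + B * x (i + 1)) - x (i + 1) * (A * y i + B * y (i + 1))"
      by (simp add: algebra_simps)
    then show ?thesis using \<open>A * x i + B * x (i + 1) = 0\<close> \<open>A * y i + B * y (i + 1) = 0\<close> by simp
  qed
  then have "A = 0" using wronskian[of i] by simp
  then show ?thesis by (simp add: A_def)
qed

text \<open>The system of a Hirzebruch surface: two fibres at \<open>k\<close> and \<open>k + 2\<close>, and two sections with opposite
  squares.\<close>

lemma quadrilateral_self_intersection:
  assumes m: "m = 4" and a0: "a k = 0" "a (k + 2) = 0"
  shows "S k = S (k + 1)" "S (k + 2) = S (k + 3)" "a (k + 1) + a (k + 3) = 0"
proof -
  show S1: "S k = S (k + 1)" using dichotomy[of k] a0 S_pos[of k] S_pos[of "k + 1"] by linarith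
  show S2: "S (k + 2) = S (k + 3)"
    using dichotomy[of "k + 2"] a0 S_pos[of "k + 2"] S_pos[of "k + 3"] by (simp add: add.assoc)
  have S4: "S (k + 4) = S k" using S_periodic[of k] m by simp
  have "(a (k + 1) + a (k + 3)) * c (k + 1) = 0" if c: "relation c" for c
  proof -
    have c4: "c (k + 4) = c k" "c (k + 3) = c (k - 1)"
      using relation_periodic[OF c, of k] relation_periodic[OF c, of "k - 1"] m by (simp_all add: ac_simps)
    have "S k * (c (k - 1) + c (k + 1)) = 0"
      using relation_eq[OF c, of k] a0 S1 by (simp add: algebra_simps)
    then have c3: "c (k + 3) = - c (k + 1)" using S_pos[of k] c4 by simp
    have "S k * c k + a (k + 1) * c (k + 1) + S (k + 2) * c (k + 2) = 0"
      using relation_eq[OF c, of "k + 1"] S1 by (simp add: add.assoc)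
    moreover have "S (k + 2) * c (k + 2) + a (k + 3) * c (k + 3) + S k * c k = 0"
      using relation_eq[OF c, of "k + 3"] S2 S4 c4 by (simp add: ac_simps)
    ultimately show ?thesis unfolding c3 by (simp add: algebra_simps)
  qed
  from this[OF x] this[OF y] show "a (k + 1) + a (k + 3) = 0"
    using wronskian[of "k + 1"] by auto
qed

end

text \<open>No class of positive square is orthogonal to a \<open>D n\<close> of nonnegative square, because \<open>D n\<close> meets
  its neighbour. For \<open>m \<ge> 5\<close> one neighbour \<open>D n\<close> of \<open>D i\<close> does not meet \<open>D j\<close> either, and a combination
  \<open>N * D i + D n\<close> with large \<open>N\<close> has positive square. For \<open>m = 4\<close> the classes \<open>D i\<close> and \<open>D j\<close> themselves
  play this part.\<close>

lemma (in geometric_surface) hodge_nonadjacent: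
  assumes "cyclic_system m S a" and D_perp: "\<And>i. chi p (D i) = 0"
    and self: "\<And>i. chi (D i) (D i) = - a i"
    and adj: "\<And>i. chi (D i) (D (i + 1)) = - S (i + 1)"
    and far: "\<And>i j. (j - i) mod int m \<ge> 2 \<Longrightarrow> (j - i) mod int m \<le> int m - 2 \<Longrightarrow> chi (D i) (D j) = 0"
    and ij: "a i \<ge> 0" "a j \<ge> 0" "(j - i) mod int m \<ge> 2" "(j - i) mod int m \<le> int m - 2"
  shows "m = 4 \<and> a i = 0 \<and> a j = 0"
proof -
  interpret cyclic_system m S a by fact
  have no_positive: "chi u u \<ge> 0" if "chi p u = 0" "chi u (D n) = 0" "a n \<ge> 0" for u n
  proof (rule ccontr)
    assume "\<not> chi u u \<ge> 0"
    then have "chi (D n) (D (n + 1)) = 0"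
      using hodge_index[of u "D n" "D (n + 1)"] that D_perp self[of n] by simp
    then show False using adj[of n] S_pos[of "n + 1"] by simp
  qed
  define d where "d = (j - i) mod int m"
  have d: "2 \<le> d" "d \<le> int m - 2" using ij by (simp_all add: d_def)
  have ji: "chi (D i) (D j) = 0" using far ij by blast
  have no5: "False" if n: "2 \<le> (j - n) mod int m" "(j - n) mod int m \<le> int m - 2"
    "chi (D i) (D n) < 0" for n
  proof -
    define N where "N = \<bar>a n\<bar> + 1"
    define u where "u = zscale N (D i) + D n"
    have "chi u (D j) = 0" using far[OF n(1,2)] ji by (simp add: u_def)
    then have "chi u u \<ge> 0" using no_positive[of u j] D_perp ij by (simp add: u_def)
    moreover have "chi u u = N * N * (- a i) + 2 * (N * chi (D i) (D n)) - a n"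
      using self[of i] self[of n] chi_perp_commute[OF D_perp D_perp, of n i]
      by (simp add: u_def algebra_simps)
    moreover have "N * N * (- a i) \<le> 0" using ij(1) by (simp add: mult_nonneg_nonpos)
    moreover have "N * chi (D i) (D n) \<le> - N" using mult_left_mono[of "chi (D i) (D n)" "- 1" N] n(3)
      by (simp add: N_def)
    ultimately show False by (simp add: N_def)
  qed
  have "m = 4"
  proof (rule ccontr)
    assume "m \<noteq> 4"
    then have m5: "int m \<ge> 5" using d by linarith
    show False
    proof (cases "d = 2")
      case False
      have "(j - (i + 1)) mod int m = (d - 1) mod int m"
        unfolding d_def by (simp add: mod_diff_left_eq algebra_simps)
      also have "\<dots> = d - 1" using d by (intro mod_pos_pos_trivial) linarith+
      finally show False using no5[of "i + 1"] adj[of i] S_pos[of "i + 1"] False d by simp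
    next
      case True
      have "(j - (i - 1)) mod int m = ((j - i) + 1) mod int m" by (simp add: algebra_simps)
      also have "\<dots> = (d + 1) mod int m" unfolding d_def by (simp only: mod_add_left_eq)
      also have "\<dots> = 3" using True m5 by simp
      finally show False
        using no5[of "i - 1"] adj[of "i - 1"] S_pos[of i] m5 chi_perp_commute[OF D_perp D_perp, of i "i - 1"]
        by simp
    qed
  qed
  moreover have "a i = 0" using no_positive[of "D i" j] D_perp ji ij self[of i] by simp
  moreover have "a j = 0"
    using no_positive[of "D j" i] D_perp ji ij self[of j] chi_perp_commute[OF D_perp D_perp, of j i]
    by simp
  ultimately show ?thesis by blast
qed

section \<open>The cyclic system of an exceptional sequence\<close>

text \<open>Mutating a pair of ranks \<open>(r, r')\<close> with pairing \<open>N\<close> to the left or to the right replaces one rank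
  by \<open>r' - N r\<close> or \<open>r - N r'\<close>. In terms of \<open>s = R/r\<close>, \<open>s' = R/r'\<close> and \<open>T = N s s'\<close> the two
  minimality conditions read \<open>2 s\<^sup>2 T \<le> T\<^sup>2\<close> and \<open>2 s'\<^sup>2 T \<le> T\<^sup>2\<close>.\<close>

lemma reduced_pair_dichotomy:
  fixes N r r' s s' R :: int
  assumes R: "R \<noteq> 0" "r * s = R" "r' * s' = R"
    and min: "r'\<^sup>2 \<le> (r' - N * r)\<^sup>2" "r\<^sup>2 \<le> (r - N * r')\<^sup>2"
  shows "N * (s * s') - s\<^sup>2 - s'\<^sup>2 \<le> - (s\<^sup>2 + s'\<^sup>2) \<or> \<bar>s\<^sup>2 - s'\<^sup>2\<bar> \<le> N * (s * s') - s\<^sup>2 - s'\<^sup>2"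
proof -
  define T where "T = N * (s * s')"
  have bound: "2 * u\<^sup>2 \<le> T"
    if min: "q'\<^sup>2 \<le> (q' - N * q)\<^sup>2" and q: "q * u = R" "q' * u' = R" and T: "T = N * (u * u')" "T > 0"
    for q q' u u'
  proof -
    have "(u * u' * q')\<^sup>2 \<le> (u * u' * (q' - N * q))\<^sup>2"
      using min by (simp add: power_mult_distrib mult_left_mono)
    also have "u * u' * q' = R * u" using q(2) by (simp add: ac_simps)
    also have "u * u' * (q' - N * q) = u * (q' * u') - N * u' * (q * u)" by (simp add: algebra_simps)
    also have "\<dots> = R * (u - N * u')" unfolding q by (simp add: algebra_simps)
    finally have "R\<^sup>2 * u\<^sup>2 \<le> R\<^sup>2 * (u - N * u')\<^sup>2" by (simp add: power_mult_distrib)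
    then have "u\<^sup>2 \<le> (u - N * u')\<^sup>2" using R(1) by simp
    then have "2 * N * u' * u \<le> N\<^sup>2 * u'\<^sup>2" by (simp add: power2_eq_square algebra_simps)
    then have "(2 * N * u' * u) * u\<^sup>2 \<le> (N\<^sup>2 * u'\<^sup>2) * u\<^sup>2" by (rule mult_right_mono) simp
    then have "T * (2 * u\<^sup>2) \<le> T * T" unfolding T(1) by (simp add: power2_eq_square algebra_simps)
    then show ?thesis using T(2) by simp
  qed
  show ?thesis
  proof (cases "T > 0")
    case True
    have "T = N * (s' * s)" by (simp add: T_def mult.commute)
    then have "2 * s\<^sup>2 \<le> T" "2 * s'\<^sup>2 \<le> T"
      using bound[OF min(1) R(2,3) T_def True] bound[OF min(2) R(3,2) _ True] by blast+
    then show ?thesis unfolding T_def[symmetric] by linarith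
  qed (simp add: T_def)
qed

lemma abel_summation:
  fixes b h :: "nat \<Rightarrow> int"
  shows "(\<Sum>i<n. - (\<Sum>j\<le>i. b j) * (h (Suc i) - h i)) = (\<Sum>i<n. b i * h i) - (\<Sum>j<n. b j) * h n"
proof (induction n)
  case (Suc n)
  then show ?case by (simp add: algebra_simps flip: lessThan_Suc_atMost)
qed simp

text \<open>An exceptional sequence whose span need not be everything but contains the point-like element
  and a canonical class \<open>k\<close> of its own.\<close>

locale nonzero_rank_sequence = surface_like chi p
  for chi :: "'a::ab_group_add \<Rightarrow> 'a \<Rightarrow> int" and p :: 'a +
  fixes xs :: "'a list" and k :: 'a
  assumes exceptional: "exceptional_seq chi xs"
    and nonzero_rank: "f \<in> set xs \<Longrightarrow> chi p f \<noteq> 0"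
    and point_in_span: "p \<in> zmod.span (set xs)"
    and k_in_span: "k \<in> zmod.span (set xs)"
    and k_perp: "chi p k = 0"
    and asym: "u \<in> zmod.span (set xs) \<Longrightarrow> v \<in> zmod.span (set xs) \<Longrightarrow>
      chi u v - chi v u = chi p u * chi k v - chi p v * chi k u"
begin

text \<open>\<open>F i\<close> is the multiple of \<open>xs ! i\<close> of rank \<open>R\<close>, so that differences lie in \<open>p\<^sup>\<bottom>\<close>. The cycle of the
  \<open>D i\<close> consists of the consecutive differences, and its last member is chosen so that the sum of all of
  them is \<open>- R k\<close>.\<close>

definition m :: nat where "m = length xs"
definition r :: "nat \<Rightarrow> int" where "r i = chi p (xs ! i)"
definition R :: int where "R = (\<Prod>i<m. r i)"
definition s :: "nat \<Rightarrow> int" where "s i = (\<Prod>j\<in>{..<m} - {i}. r j)"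
definition F :: "nat \<Rightarrow> 'a" where "F i = zscale (s i) (xs ! i)"
definition nxt :: "nat \<Rightarrow> nat" where "nxt i = (if Suc i = m then 0 else Suc i)"
definition D :: "nat \<Rightarrow> 'a" where "D i = F (nxt i) - F i - (if Suc i = m then zscale R k else 0)"

text \<open>The pairing of \<open>xs ! i\<close> with its successor in the helix; for the last element the successor is the
  first one mutated through all the others.\<close>

definition N :: "nat \<Rightarrow> int" where
  "N i = (if Suc i = m then r i * chi k (xs ! 0) - r 0 * chi k (xs ! i) - r 0 * r i * chi k k
     else chi (xs ! i) (xs ! Suc i))"

lemma r_nonzero: "i < m \<Longrightarrow> r i \<noteq> 0"
  using nonzero_rank by (simp add: r_def m_def)

lemma R_nonzero: "R \<noteq> 0"
  using r_nonzero by (simp add: R_def)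

lemma r_s: "i < m \<Longrightarrow> r i * s i = R"
  unfolding R_def s_def by (simp add: prod.remove[of "{..<m}" i])

lemma s_nonzero: "i < m \<Longrightarrow> s i \<noteq> 0"
  using r_s[of i] R_nonzero by auto

lemma nth_in_span: "i < m \<Longrightarrow> xs ! i \<in> zmod.span (set xs)"
  by (intro zmod.span_base) (simp add: m_def)

lemma F_in_span: "i < m \<Longrightarrow> F i \<in> zmod.span (set xs)"
  unfolding F_def by (intro zmod.span_scale nth_in_span)

lemma rank_F: "i < m \<Longrightarrow> chi p (F i) = R"
  using r_s by (simp add: F_def r_def[symmetric] mult.commute)

lemma nxt_less: "m > 0 \<Longrightarrow> i < m \<Longrightarrow> nxt i < m"
  by (simp add: nxt_def)

lemma D_perp: "i < m \<Longrightarrow> chi p (D i) = 0"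
  using nxt_less[of i] rank_F by (simp add: D_def k_perp)

lemma chi_F_self: "i < m \<Longrightarrow> chi (F i) (F i) = (s i)\<^sup>2"
  using exceptional_seq_nth(1)[OF exceptional] by (simp add: F_def m_def power2_eq_square)

lemma chi_F_greater: "j < i \<Longrightarrow> i < m \<Longrightarrow> chi (F i) (F j) = 0"
  using exceptional_seq_nth(2)[OF exceptional] by (simp add: F_def m_def)

lemma chi_F_less: "i < j \<Longrightarrow> j < m \<Longrightarrow> chi (F i) (F j) = R * (chi k (F j) - chi k (F i))"
  using asym[of "F i" "F j"] F_in_span[of i] F_in_span[of j] rank_F[of i] rank_F[of j]
    chi_F_greater[of i j] by (simp add: algebra_simps)

lemma chi_F_k: "i < m \<Longrightarrow> chi (F i) k = chi k (F i) + R * chi k k"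
  using asym[of "F i" k] F_in_span k_in_span rank_F k_perp by (simp add: algebra_simps)

lemma D_self:
  assumes m: "m \<ge> 3" and i: "i < m"
  shows "- chi (D i) (D i) = N i * (s i * s (nxt i)) - (s i)\<^sup>2 - (s (nxt i))\<^sup>2"
proof (cases "Suc i = m")
  case True
  have F0: "0 < i" "0 < m" using True m by simp_all
  have "N i * (s i * s 0) = (r i * s i) * chi k (F 0) - (r 0 * s 0) * chi k (F i) - (r i * s i) * (r 0 * s 0) * chi k k"
    using True by (simp add: N_def F_def algebra_simps)
  then have "N i * (s i * s 0) = R * chi k (F 0) - R * chi k (F i) - R * R * chi k k"
    using r_s i F0 by simp
  moreover have "chi (D i) (D i) = (s 0)\<^sup>2 + (s i)\<^sup>2 - R * (chi k (F 0) - chi k (F i)) + R * R * chi k k"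
    using True F0 i chi_F_self[of 0] chi_F_self[of i] chi_F_greater[of 0 i] chi_F_less[of 0 i]
      chi_F_k[of 0] chi_F_k[of i]
    by (simp add: D_def nxt_def algebra_simps)
  ultimately show ?thesis using True by (simp add: nxt_def algebra_simps)
next
  case False
  then have "Suc i < m" using i by simp
  then show ?thesis
    using False chi_F_self[of i] chi_F_self[of "Suc i"] chi_F_greater[of i "Suc i"]
    by (simp add: D_def nxt_def N_def F_def algebra_simps)
qed

text \<open>For \<open>j < m - 1\<close> exceptionality leaves at most one term. For \<open>j = m - 1\<close> the terms from the
  asymmetry of \<open>\<chi>\<close> cancel against those from \<open>R k\<close> in \<open>D j\<close>.\<close>

lemma D_gram_less:
  assumes m: "m \<ge> 3" and ij: "i < j" "j < m"
  shows "chi (D i) (D j) = (if j = nxt i then - (s j)\<^sup>2 else 0) + (if i = nxt j then - (s i)\<^sup>2 else 0)"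
proof (cases "Suc j = m")
  case True
  have *: "chi (F (Suc i)) (F j) = (if Suc i = j then (s j)\<^sup>2 else 0) + R * (chi k (F j) - chi k (F (Suc i)))"
    using chi_F_self[of j] chi_F_less[of "Suc i" j] ij by (cases "Suc i = j") simp_all
  have "chi (F i) (F 0) = (if i = 0 then (s 0)\<^sup>2 else 0)"
    using chi_F_self[of 0] chi_F_greater[of 0 i] ij by (cases "i = 0") simp_all
  then show ?thesis
    using True ij * chi_F_greater[of 0 "Suc i"] chi_F_less[of i j] chi_F_k[of i] chi_F_k[of "Suc i"]
    by (auto simp: D_def nxt_def algebra_simps)
next
  case False
  then have j: "Suc j < m" using ij by simp
  have "chi (F j) (F (Suc i)) = (if Suc i = j then (s j)\<^sup>2 else 0)"
    using chi_F_self[of j] chi_F_greater[of "Suc i" j] ij by (cases "Suc i = j") simp_all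
  then have "chi (D j) (D i) = (if j = nxt i then - (s j)\<^sup>2 else 0)"
    using False j ij chi_F_greater[of i j] chi_F_greater[of i "Suc j"] chi_F_greater[of "Suc i" "Suc j"]
    by (auto simp: D_def nxt_def)
  then show ?thesis using chi_perp_commute[of "D i" "D j"] D_perp ij False by (simp add: nxt_def)
qed

lemma D_gram:
  assumes m: "m \<ge> 3" and ij: "i < m" "j < m" "i \<noteq> j"
  shows "chi (D i) (D j) = (if j = nxt i then - (s j)\<^sup>2 else 0) + (if i = nxt j then - (s i)\<^sup>2 else 0)"
  using D_gram_less[OF m, of i j] D_gram_less[OF m, of j i] ij
    chi_perp_commute[of "D i" "D j"] D_perp[of i] D_perp[of j]
  by (cases i j rule: linorder_cases) (simp_all add: add.commute)

lemma sum_D: 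
  assumes m: "m > 0"
  shows "(\<Sum>i<m. chi (D i) w) = - R * chi k w"
proof -
  obtain l where l: "m = Suc l" using m by (cases m) auto
  have "(\<Sum>i<l. chi (D i) w) = (\<Sum>i<l. chi (F (Suc i)) w - chi (F i) w)"
    by (intro sum.cong) (simp_all add: D_def nxt_def l)
  also have "\<dots> = chi (F l) w - chi (F 0) w" by (rule sum_lessThan_telescope)
  finally show ?thesis by (simp add: l D_def nxt_def)
qed

text \<open>Summation by parts turns an element of rank \<open>0\<close> in the span into a combination of the
  differences \<open>F (Suc i) - F i\<close>.\<close>

lemma perp_combination:
  assumes v: "v \<in> zmod.span (set xs)" "chi p v = 0" and m: "m \<ge> 2"
  obtains X where "X (m - 1) = 0" "X (m - 2) = r (m - 1) * chi (xs ! (m - 1)) v"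
    "\<And>w. (\<Sum>i<m. X i * chi (D i) w) = R * chi v w"
proof -
  have "m = Suc (Suc (m - 2))" using m by simp
  then obtain l where l: "m = Suc (Suc l)" by blast
  obtain \<beta> where "v = (\<Sum>i<length xs. zscale (\<beta> i) (xs ! i))"
    using span_list_obtain_coeffs[OF v(1)] by blast
  then have \<beta>: "v = (\<Sum>i<m. zscale (\<beta> i) (xs ! i))" by (simp add: m_def)
  define b where "b i = \<beta> i * r i" for i
  define X where "X i = - (\<Sum>j\<le>i. b j)" for i
  have "(\<Sum>i<m. b i) = chi p v" unfolding \<beta> by (simp add: chi_sum b_def r_def)
  then have b_sum: "(\<Sum>i<m. b i) = 0" using v(2) by simp
  have "{..m - 1} = {..<m}" "{..m - 2} = {..<m - 1}" using m by auto
  then have X_last: "X (m - 1) = 0" and "X (m - 2) = - (\<Sum>i<m - 1. b i)"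
    using b_sum by (simp_all add: X_def)
  then have X_l: "X (m - 2) = b (m - 1)" using b_sum by (simp add: l)
  have "chi (xs ! (m - 1)) v = (\<Sum>i<m. \<beta> i * chi (xs ! (m - 1)) (xs ! i))"
    unfolding \<beta> by (simp add: chi_sum)
  also have "\<dots> = (\<Sum>i<m. if i = m - 1 then \<beta> i else 0)"
    using exceptional_seq_nth[OF exceptional] m by (intro sum.cong) (auto simp: m_def)
  also have "\<dots> = \<beta> (m - 1)" using m by simp
  finally have X_2: "X (m - 2) = r (m - 1) * chi (xs ! (m - 1)) v" using X_l by (simp add: b_def)
  have "(\<Sum>i<m. X i * chi (D i) w) = R * chi v w" for w
  proof -
    have "(\<Sum>i<m. X i * chi (D i) w) = (\<Sum>i<Suc l. X i * chi (D i) w)"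
      using X_last by (simp add: l)
    also have "\<dots> = (\<Sum>i<Suc l. - (\<Sum>j\<le>i. b j) * (chi (F (Suc i)) w - chi (F i) w))"
      by (intro sum.cong) (simp_all add: D_def nxt_def l X_def)
    also have "\<dots> = (\<Sum>i<Suc l. b i * chi (F i) w) - (\<Sum>j<Suc l. b j) * chi (F (Suc l)) w"
      by (rule abel_summation)
    also have "(\<Sum>j<Suc l. b j) = - b (Suc l)" using b_sum by (simp add: l)
    also have "(\<Sum>i<Suc l. b i * chi (F i) w) - - b (Suc l) * chi (F (Suc l)) w =
        (\<Sum>i<m. b i * chi (F i) w)" by (simp add: l)
    also have "\<dots> = (\<Sum>i<m. R * (\<beta> i * chi (xs ! i) w))"
    proof (intro sum.cong refl)
      fix i assume "i \<in> {..<m}"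
      then have rs: "r i * s i = R" using r_s by simp
      have "b i * chi (F i) w = (r i * s i) * (\<beta> i * chi (xs ! i) w)" by (simp add: b_def F_def)
      then show "b i * chi (F i) w = R * (\<beta> i * chi (xs ! i) w)" unfolding rs .
    qed
    also have "\<dots> = R * chi v w" unfolding \<beta> by (simp add: chi_sum sum_distrib_left)
    finally show ?thesis .
  qed
  then show ?thesis using that X_last X_2 by blast
qed

text \<open>Pairing \<open>p\<close> with the first and the last element gives its extreme coordinates, which are the
  ranks; for fewer than three elements this contradicts \<open>\<chi>(p, p) = 0\<close>.\<close>

lemma m_ge_3: "m \<ge> 3"
proof (rule ccontr)
  assume "\<not> m \<ge> 3"
  obtain \<alpha> where "p = (\<Sum>i<length xs. zscale (\<alpha> i) (xs ! i))"
    using span_list_obtain_coeffs[OF point_in_span] by blast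
  then have \<alpha>: "p = (\<Sum>i<m. zscale (\<alpha> i) (xs ! i))" by (simp add: m_def)
  have p0: "p \<noteq> 0" using primitive_point by (simp add: primitive_elt_def)
  have "chi p p = (\<Sum>i<m. \<alpha> i * r i)"
    using arg_cong[OF \<alpha>, of "chi p"] by (simp add: chi_sum r_def)
  then have sum0: "(\<Sum>i<m. \<alpha> i * r i) = 0" by simp
  have first: "r j = (\<Sum>i<m. \<alpha> i * chi (xs ! i) (xs ! j))"
    and last: "r j = (\<Sum>i<m. \<alpha> i * chi (xs ! j) (xs ! i))" for j
    using arg_cong[OF \<alpha>, of "\<lambda>v. chi v (xs ! j)"] arg_cong[OF \<alpha>, of "chi (xs ! j)"]
      chi_point_commute[of "xs ! j"] by (simp_all add: chi_sum r_def)
  consider "m = 0" | "m = 1" | "m = 2" using \<open>\<not> m \<ge> 3\<close> by linarith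
  then show False
  proof cases
    case 1
    then show False using \<alpha> p0 by simp
  next
    case 2
    then show False using first[of 0] sum0 r_nonzero[of 0] exceptional_seq_nth(1)[OF exceptional, of 0]
      by (simp add: m_def)
  next
    case 3
    have "{..<m} = {0, 1}" using 3 by auto
    then have "\<alpha> 0 = r 0" "\<alpha> 1 = r 1" "\<alpha> 0 * r 0 + \<alpha> 1 * r 1 = 0"
      using first[of 0] last[of 1] sum0 3 exceptional_seq_nth[OF exceptional] by (simp_all add: m_def)
    then show False using r_nonzero[of 0] 3 by (simp add: sum_squares_eq_zero_iff)
  qed
qed

text \<open>Pairing a combination of the \<open>D u\<close> with \<open>D i\<close> involves three terms, since only cyclic neighbours
  meet.\<close>

lemma D_row_sum:
  assumes i: "i < m" "i' < m" "nxt i' = i"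
  shows "(\<Sum>u<m. c u * chi (D u) (D i)) =
    - ((s i)\<^sup>2 * c i' + - chi (D i) (D i) * c i + (s (nxt i))\<^sup>2 * c (nxt i))"
proof -
  have distinct: "i' \<noteq> i" "nxt i \<noteq> i" "i' \<noteq> nxt i" "nxt (nxt i) \<noteq> i"
    using i m_ge_3 by (auto simp: nxt_def split: if_splits)
  have nxt_inj: "nxt u = i \<Longrightarrow> u < m \<Longrightarrow> u = i'" for u
    using i by (auto simp: nxt_def split: if_splits)
  have less: "nxt i < m" using i m_ge_3 nxt_less by simp
  have "(\<Sum>u<m. c u * chi (D u) (D i)) = (\<Sum>u\<in>{i', i, nxt i}. c u * chi (D u) (D i))"
  proof (intro sum.mono_neutral_right ballI)
    show "{i', i, nxt i} \<subseteq> {..<m}" using i less by simp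
    fix u assume u: "u \<in> {..<m} - {i', i, nxt i}"
    then have "nxt u \<noteq> i" using nxt_inj by blast
    then show "c u * chi (D u) (D i) = 0" using D_gram[OF m_ge_3, of u i] u i(1) by simp
  qed simp
  also have "\<dots> = c i' * - (s i)\<^sup>2 + c i * chi (D i) (D i) + c (nxt i) * - (s (nxt i))\<^sup>2"
    using distinct i less D_gram[OF m_ge_3, of i' i] D_gram[OF m_ge_3, of "nxt i" i] by simp
  finally show ?thesis by (simp add: algebra_simps)
qed

end

section \<open>Ranks of a norm-minimal sequence\<close>

text \<open>The last hypothesis is the Markov equation weakened to an inequality. The bound on \<open>z\<close> makes the
  left-hand side too large as soon as \<open>x \<ge> 2\<close>, and for \<open>x = 1\<close> it leaves only \<open>z = y\<close>.\<close>

lemma unit_triple_ordered: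
  fixes x y z :: int
  assumes "1 \<le> x" "x \<le> y" "y \<le> z" "z * z \<le> x * x + y * y" "3 * (x * y * z) \<le> x * x + y * y + z * z"
  shows "x = 1 \<and> y = 1 \<and> z = 1"
proof (cases "x = 1")
  case True
  have "z = y"
  proof (rule ccontr)
    assume "z \<noteq> y"
    then have "(y + 1) * (y + 1) \<le> z * z" using assms by (intro mult_mono) simp_all
    then show False using assms(4) True assms(2) by (simp add: algebra_simps)
  qed
  then have "y * y \<le> 1 * 1" using assms(5) True by simp
  then have "y \<le> 1" using assms(1,2) by (intro power2_le_imp_le[of y 1]) (simp_all add: power2_eq_square)
  then show ?thesis using True \<open>z = y\<close> assms by simp
next
  case False
  then have x: "x \<ge> 2" using assms(1) by simp
  have "2 * (y * y) \<le> x * (y * z)"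
    using x assms by (intro mult_mono) simp_all
  moreover have "x * x \<le> y * y" using assms by (intro mult_mono) simp_all
  moreover have "0 < y * y" using assms by simp
  ultimately show ?thesis using assms(4,5) by (simp add: mult.assoc)
qed

lemma unit_triple:
  fixes x y z :: int
  assumes pos: "1 \<le> x" "1 \<le> y" "1 \<le> z"
    and tri: "z * z \<le> x * x + y * y" "x * x \<le> y * y + z * z" "y * y \<le> x * x + z * z"
    and le: "3 * (x * y * z) \<le> x * x + y * y + z * z"
  shows "x = 1 \<and> y = 1 \<and> z = 1"
proof -
  consider "x \<le> y \<and> y \<le> z" | "x \<le> z \<and> z \<le> y" | "y \<le> x \<and> x \<le> z" | "y \<le> z \<and> z \<le> x"
    | "z \<le> x \<and> x \<le> y" | "z \<le> y \<and> y \<le> x" by linarith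
  then show ?thesis
  proof cases
    case 1 then show ?thesis using unit_triple_ordered[of x y z] assms by linarith
  next
    case 2 then show ?thesis using unit_triple_ordered[of x z y] assms by (simp add: ac_simps)
  next
    case 3 then show ?thesis using unit_triple_ordered[of y x z] assms by (simp add: ac_simps)
  next
    case 4 then show ?thesis using unit_triple_ordered[of y z x] assms by (simp add: ac_simps)
  next
    case 5 then show ?thesis using unit_triple_ordered[of z x y] assms by (simp add: ac_simps)
  next
    case 6 then show ?thesis using unit_triple_ordered[of z y x] assms by (simp add: ac_simps)
  qed
qed

locale minimal_sequence = nonzero_rank_sequence chi p xs k + geometric_surface chi p kap
  for chi :: "'a::ab_group_add \<Rightarrow> 'a \<Rightarrow> int" and p :: 'a and xs :: "'a list" and k kap :: 'a +
  assumes minimal: "i < m \<Longrightarrow> (r (nxt i))\<^sup>2 \<le> (r (nxt i) - N i * r i)\<^sup>2"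
    "i < m \<Longrightarrow> (r i)\<^sup>2 \<le> (r i - N i * r (nxt i))\<^sup>2"
begin

text \<open>Reduction of integer indices modulo \<open>m\<close> makes the cycle periodic, with \<open>i - 1\<close> as the cyclic
  predecessor.\<close>

definition idx :: "int \<Rightarrow> nat" where "idx i = nat (i mod int m)"
definition S :: "int \<Rightarrow> int" where "S i = (s (idx i))\<^sup>2"
definition a :: "int \<Rightarrow> int" where "a i = - chi (D (idx i)) (D (idx i))"

lemma idx_less: "idx i < m"
  using m_ge_3 by (simp add: idx_def nat_less_iff)

lemma idx_periodic: "idx (i + int m) = idx i"
  by (simp add: idx_def)

lemma idx_int: "j < m \<Longrightarrow> idx (int j) = j"
  by (simp add: idx_def)

lemma idx_eq_iff: "idx i = idx j \<longleftrightarrow> i mod int m = j mod int m"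
proof -
  have "i mod int m \<ge> 0" "j mod int m \<ge> 0" using m_ge_3 by simp_all
  then show ?thesis unfolding idx_def by (rule eq_nat_nat_iff)
qed

lemma idx_Suc: "idx (i + 1) = nxt (idx i)"
proof -
  have i: "int (idx i) = i mod int m" using m_ge_3 by (simp add: idx_def)
  have "(i + 1) mod int m = (i mod int m + 1) mod int m" by (simp add: mod_add_left_eq)
  also have "\<dots> = int (nxt (idx i))"
  proof (cases "Suc (idx i) = m")
    case True
    then have "i mod int m + 1 = int m" using i by linarith
    then show ?thesis using True by (simp add: nxt_def)
  next
    case False
    then show ?thesis using idx_less[of i] by (simp add: nxt_def flip: i)
  qed
  finally show ?thesis by (simp add: idx_def)
qed

lemma nxt_idx_pred: "nxt (idx (i - 1)) = idx i"
  using idx_Suc[of "i - 1"] by simp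

sublocale cyclic_system m S a
proof
  show "3 \<le> m" by (rule m_ge_3)
  show "S (i + int m) = S i" "a (i + int m) = a i" for i
    by (simp_all add: S_def a_def idx_periodic)
  show "0 < S i" for i using s_nonzero[OF idx_less] by (simp add: S_def)
  show "a i \<le> - (S i + S (i + 1)) \<or> \<bar>S i - S (i + 1)\<bar> \<le> a i" for i
  proof -
    have l: "idx i < m" "nxt (idx i) < m" using idx_less[of i] nxt_less m_ge_3 by simp_all
    show ?thesis
      using reduced_pair_dichotomy[OF R_nonzero r_s[OF l(1)] r_s[OF l(2)] minimal[OF l(1)]]
      unfolding a_def S_def idx_Suc D_self[OF m_ge_3 l(1)] by simp
  qed
qed

lemma relationI:
  assumes "\<And>j. j < m \<Longrightarrow> (\<Sum>i<m. c i * chi (D i) (D j)) = 0"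
  shows "relation (\<lambda>i. c (idx i))"
  unfolding relation_def
proof (intro conjI allI)
  fix i
  have "(\<Sum>u<m. c u * chi (D u) (D (idx i))) = - (S i * c (idx (i - 1)) + a i * c (idx i) + S (i + 1) * c (idx (i + 1)))"
    unfolding S_def a_def idx_Suc
    by (rule D_row_sum) (simp_all add: idx_less nxt_idx_pred)
  then show "S i * c (idx (i - 1)) + a i * c (idx i) + S (i + 1) * c (idx (i + 1)) = 0"
    using assms[OF idx_less[of i]] by simp
qed (simp add: idx_periodic)

text \<open>Both \<open>p\<close> and the canonical class become relations between the \<open>D i\<close>; only the second one involves
  the last of them.\<close>

lemma exists_relations:
  obtains x y where "cyclic_system_with_relations m S a x y"
proof -
  have m2: "m \<ge> 2" using m_ge_3 by simp
  obtain X where X: "X (m - 1) = 0" "X (m - 2) = r (m - 1) * chi (xs ! (m - 1)) p"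
    "\<And>w. (\<Sum>i<m. X i * chi (D i) w) = R * chi p w"
    using perp_combination[OF point_in_span _ m2] by auto
  obtain Y where Y: "Y (m - 1) = 0" "Y (m - 2) = r (m - 1) * chi (xs ! (m - 1)) k"
    "\<And>w. (\<Sum>i<m. Y i * chi (D i) w) = R * chi k w"
    using perp_combination[OF k_in_span k_perp m2] by auto
  have x: "relation (\<lambda>i. X (idx i))"
    by (rule relationI) (simp add: X(3) D_perp)
  have y: "relation (\<lambda>i. 1 + Y (idx i))"
  proof (rule relationI)
    fix j
    show "(\<Sum>i<m. (1 + Y i) * chi (D i) (D j)) = 0"
      using Y(3)[of "D j"] sum_D[of "D j"] m2 by (simp add: distrib_right sum.distrib)
  qed
  have "idx (int (m - 2)) = m - 2" "idx (int (m - 2) + 1) = m - 1"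
    using idx_int[of "m - 2"] idx_int[of "m - 1"] m2 by (simp_all add: idx_Suc nxt_def)
  moreover have "X (m - 2) \<noteq> 0"
    using r_nonzero[of "m - 1"] m2 chi_point_commute[of "xs ! (m - 1)"] by (simp add: X(2) r_def)
  ultimately have "X (idx (int (m - 2))) * (1 + Y (idx (int (m - 2) + 1))) \<noteq>
      X (idx (int (m - 2) + 1)) * (1 + Y (idx (int (m - 2))))"
    using X(1) Y(1) by simp
  from wronskian_nonzero[OF x y this]
  have "cyclic_system_with_relations m S a (\<lambda>i. X (idx i)) (\<lambda>i. 1 + Y (idx i))"
    by unfold_locales (use x y in auto)
  then show ?thesis by (rule that)
qed

text \<open>The sum of all \<open>D i\<close> is \<open>- R k\<close>; its square is computed by rows of the Gram matrix.\<close>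

lemma canonical_square: "R\<^sup>2 * chi k k = - (\<Sum>i<m. S (int i) + a (int i) + S (int i + 1))"
proof -
  have "(\<Sum>j<m. \<Sum>i<m. 1 * chi (D i) (D j)) = (\<Sum>j<m. - (S (int j) + a (int j) + S (int j + 1)))"
  proof (intro sum.cong refl)
    fix j assume "j \<in> {..<m}"
    then have j: "idx (int j) = j" by (simp add: idx_int)
    show "(\<Sum>i<m. 1 * chi (D i) (D j)) = - (S (int j) + a (int j) + S (int j + 1))"
      using D_row_sum[OF idx_less idx_less nxt_idx_pred, of "\<lambda>_. 1" "int j"]
      unfolding S_def a_def idx_Suc j by simp
  qed
  also have "\<dots> = - (\<Sum>j<m. S (int j) + a (int j) + S (int j + 1))" by (rule sum_negf)
  finally have "(\<Sum>j<m. \<Sum>i<m. 1 * chi (D i) (D j)) = - (\<Sum>j<m. S (int j) + a (int j) + S (int j + 1))" .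
  moreover have "(\<Sum>j<m. \<Sum>i<m. 1 * chi (D i) (D j)) = R\<^sup>2 * chi k k"
  proof -
    have "(\<Sum>j<m. \<Sum>i<m. 1 * chi (D i) (D j)) = (\<Sum>j<m. - R * chi k (D j))"
      using sum_D m_ge_3 by simp
    also have "\<dots> = - R * (\<Sum>j<m. chi (D j) k)"
      unfolding sum_distrib_left
      by (intro sum.cong refl) (simp add: chi_perp_commute[OF k_perp D_perp])
    also have "\<dots> = R\<^sup>2 * chi k k" using sum_D[of k] m_ge_3 by (simp add: power2_eq_square)
    finally show ?thesis .
  qed
  ultimately show ?thesis by simp
qed

lemma far_orthogonal:
  assumes "(j - i) mod int m \<ge> 2" "(j - i) mod int m \<le> int m - 2"
  shows "chi (D (idx i)) (D (idx j)) = 0"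
proof -
  have "idx i \<noteq> idx j"
  proof
    assume "idx i = idx j"
    then have "(j - i) mod int m = (j - j) mod int m"
      unfolding idx_eq_iff by (intro mod_diff_cong) simp_all
    then show False using assms by simp
  qed
  moreover have "idx j \<noteq> idx (i + 1)"
  proof
    assume "idx j = idx (i + 1)"
    then have "(j - i) mod int m = (i + 1 - i) mod int m"
      unfolding idx_eq_iff by (rule mod_diff_cong) simp
    then show False using assms m_ge_3 by simp
  qed
  moreover have "idx i \<noteq> idx (j + 1)"
  proof
    assume "idx i = idx (j + 1)"
    then have "(j - i) mod int m = (j - (j + 1)) mod int m"
      unfolding idx_eq_iff by (intro mod_diff_cong) simp_all
    also have "\<dots> = int m - 1" using m_ge_3 by (simp add: zmod_minus1)
    finally show False using assms by simp
  qed
  ultimately show ?thesis using D_gram[OF m_ge_3 idx_less idx_less] by (simp add: idx_Suc)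
qed

lemma S_r: "S i * (r (idx i))\<^sup>2 = R\<^sup>2"
  using r_s[OF idx_less[of i]] by (simp add: S_def mult.commute flip: power_mult_distrib)

text \<open>For \<open>m = 3\<close> the squares \<open>a i\<close> are fourth powers of the ranks, the dichotomy becomes the bound of
  each squared rank by the sum of the other two, and \<open>square\<close> becomes the Markov inequality. For
  \<open>m = 4\<close> one has \<open>R\<^sup>2 * chi k k = - 4 * (S n + S (n + 2))\<close> with \<open>S t \<le> R\<^sup>2\<close>, so \<open>square\<close> forces
  \<open>S t = R\<^sup>2\<close>.\<close>

lemma ranks_are_units:
  assumes square: "chi k k \<le> int m - 12"
  shows "\<And>i. i < m \<Longrightarrow> (r i)\<^sup>2 = 1" and "chi k k = int m - 12"
proof -
  obtain x y where "cyclic_system_with_relations m S a x y" using exists_relations .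
  then interpret rel: cyclic_system_with_relations m S a x y .
  have "(\<forall>i<m. (r i)\<^sup>2 = 1) \<and> chi k k = int m - 12"
  proof (cases "m = 3")
    case True
    have id3: "idx 0 = 0" "idx 1 = 1" "idx 2 = 2" using idx_int[of 0] idx_int[of 1] idx_int[of 2] True by simp_all
    have S3: "S 3 = S 0" "S 4 = S 1" using S_periodic[of 0] S_periodic[of 1] True by simp_all
    define u v w where "u = \<bar>r 0\<bar>" and "v = \<bar>r 1\<bar>" and "w = \<bar>r 2\<bar>"
    have pos: "u \<ge> 1" "v \<ge> 1" "w \<ge> 1"
      using r_nonzero[of 0] r_nonzero[of 1] r_nonzero[of 2] True by (simp_all add: u_def v_def w_def)
    have "{..<m} = {0, 1, 2}" using True by auto
    then have "\<bar>R\<bar> = u * v * w" by (simp add: R_def u_def v_def w_def abs_mult)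
    then have R2: "R\<^sup>2 = (u * v * w)\<^sup>2" by (metis power2_abs)
    have SS: "S 0 = (v * w)\<^sup>2" "S 1 = (u * w)\<^sup>2" "S 2 = (u * v)\<^sup>2"
    proof -
      have "S 0 * u\<^sup>2 = (v * w)\<^sup>2 * u\<^sup>2" "S 1 * v\<^sup>2 = (u * w)\<^sup>2 * v\<^sup>2" "S 2 * w\<^sup>2 = (u * v)\<^sup>2 * w\<^sup>2"
        using S_r[of 0] S_r[of 1] S_r[of 2] id3 unfolding R2 u_def v_def w_def
        by (simp_all add: power_mult_distrib ac_simps)
      then show "S 0 = (v * w)\<^sup>2" "S 1 = (u * w)\<^sup>2" "S 2 = (u * v)\<^sup>2" using pos by simp_all
    qed
    have aa: "a 0 = (w * w)\<^sup>2" "a 1 = (u * u)\<^sup>2" "a 2 = (v * v)\<^sup>2"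
    proof -
      have "a 0 * (u * v)\<^sup>2 = (w * w)\<^sup>2 * (u * v)\<^sup>2" "a 1 * (v * w)\<^sup>2 = (u * u)\<^sup>2 * (v * w)\<^sup>2"
        "a 2 * (u * w)\<^sup>2 = (v * v)\<^sup>2 * (u * w)\<^sup>2"
        using rel.triangle_self_intersection[OF True, of 0] rel.triangle_self_intersection[OF True, of 1]
          rel.triangle_self_intersection[OF True, of 2] S3
        by (simp_all add: SS power_mult_distrib ac_simps)
      then show "a 0 = (w * w)\<^sup>2" "a 1 = (u * u)\<^sup>2" "a 2 = (v * v)\<^sup>2" using pos by simp_all
    qed
    have "\<bar>S 0 - S 1\<bar> \<le> a 0" "\<bar>S 1 - S 2\<bar> \<le> a 1" "\<bar>S 2 - S 3\<bar> \<le> a 2"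
      using dichotomy[of 0] dichotomy[of 1] dichotomy[of 2] S_pos[of 0] S_pos[of 1] S_pos[of 2] S_pos[of 3]
        aa by (simp_all, smt (verit) zero_le_power2)+
    then have ineq: "\<bar>S 0 - S 1\<bar> \<le> a 0" "\<bar>S 1 - S 2\<bar> \<le> a 1" "\<bar>S 2 - S 0\<bar> \<le> a 2"
      using S3 by simp_all
    have cancel: "\<bar>c * c - b * b\<bar> \<le> d * d"
      if "\<bar>(c * d)\<^sup>2 - (b * d)\<^sup>2\<bar> \<le> (d * d)\<^sup>2" "d \<ge> 1" for b c d :: int
    proof -
      have "(c * d)\<^sup>2 - (b * d)\<^sup>2 = (d * d) * (c * c - b * b)" by (simp add: power2_eq_square algebra_simps)
      then have "(d * d) * \<bar>c * c - b * b\<bar> \<le> (d * d) * (d * d)"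
        using that(1) by (simp add: abs_mult power2_eq_square)
      then show ?thesis by (rule mult_left_le_imp_le) (use that(2) in simp)
    qed
    have tri: "\<bar>v * v - u * u\<bar> \<le> w * w" "\<bar>w * w - v * v\<bar> \<le> u * u" "\<bar>u * u - w * w\<bar> \<le> v * v"
      using ineq pos unfolding SS aa by (auto intro!: cancel simp: mult.commute)
    have "R\<^sup>2 * chi k k = - ((u * u + v * v + w * w)\<^sup>2)"
      unfolding canonical_square using S3
      by (simp add: True numeral_3_eq_3 SS aa power2_eq_square algebra_simps)
    then have sq: "(u * v * w)\<^sup>2 * (- chi k k) = (u * u + v * v + w * w)\<^sup>2" unfolding R2 by simp
    have "(u * v * w)\<^sup>2 * 9 \<le> (u * v * w)\<^sup>2 * (- chi k k)"
      using square True by (intro mult_left_mono) simp_all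
    then have "(3 * (u * v * w))\<^sup>2 \<le> (u * u + v * v + w * w)\<^sup>2"
      unfolding sq by (simp add: power_mult_distrib)
    then have "3 * (u * v * w) \<le> u * u + v * v + w * w"
      by (rule power2_le_imp_le) simp
    then have uvw: "u = 1 \<and> v = 1 \<and> w = 1" using tri pos by (intro unit_triple) linarith+
    then have "(r 0)\<^sup>2 = 1" "(r 1)\<^sup>2 = 1" "(r 2)\<^sup>2 = 1"
      unfolding u_def v_def w_def by (simp_all add: abs_eq_iff' power2_eq_1_iff)
    moreover have "chi k k = - 9" using sq uvw by simp
    moreover have "i = 0 \<or> i = 1 \<or> i = 2" if "i < m" for i using that True by linarith
    ultimately show ?thesis using True by auto
  next
    case False
    then have m4: "m \<ge> 4" using m_ge_3 by simp
    obtain i j where ij: "a i \<ge> 0" "a j \<ge> 0" "(j - i) mod int m \<ge> 2" "(j - i) mod int m \<le> int m - 2"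
      using rel.exists_nonadjacent_nonneg[OF m4] by blast
    have adj: "chi (D (idx n)) (D (idx (n + 1))) = - S (n + 1)" for n
    proof -
      have "nxt (idx n) \<noteq> idx n" "nxt (nxt (idx n)) \<noteq> idx n" using m_ge_3 idx_less[of n] by (auto simp: nxt_def split: if_splits)
      then show ?thesis
        using D_gram[OF m_ge_3 idx_less[of n] idx_less[of "n + 1"]] by (simp add: idx_Suc S_def)
    qed
    have *: "m = 4 \<and> a i = 0 \<and> a j = 0"
      by (rule hodge_nonadjacent[OF cyclic_system_axioms, where D = "\<lambda>n. D (idx n)"])
        (simp_all add: D_perp idx_less a_def[symmetric] adj far_orthogonal ij, simp add: a_def)
    then have m: "m = 4" by simp
    have "(j - i) mod 4 = 2" using ij m by simp
    then have "a j = a (i + 2)" using periodic_cong[of a j i 2] a_periodic m by simp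
    define n where "n = i mod 4"
    have n4: "n = 0 \<or> n = 1 \<or> n = 2 \<or> n = 3" unfolding n_def by linarith
    have an: "a n = 0" "a (n + 2) = 0"
    proof -
      have "a (i mod int m) = a i" by (rule periodic_mod) (rule a_periodic)
      then show "a n = 0" using * by (simp add: n_def)
      have "(i + 2) mod int m = (n + 2) mod int m" by (simp add: n_def m mod_add_left_eq)
      moreover have "a ((i + 2) mod int m) = a (i + 2)" "a ((n + 2) mod int m) = a (n + 2)"
        by (rule periodic_mod, rule a_periodic)+
      ultimately show "a (n + 2) = 0" using * \<open>a j = a (i + 2)\<close> by simp
    qed
    note quad = rel.quadrilateral_self_intersection[OF m an]
    have per: "S (t + 4) = S t" "a (t + 4) = a t" for t
      using S_periodic[of t] a_periodic[of t] m by simp_all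
    have per': "S 4 = S 0" "S 5 = S 1" "S 6 = S 2" "a 4 = a 0" "a 5 = a 1" "a 6 = a 2"
      using per[of 0] per[of 1] per[of 2] by simp_all
    have "R\<^sup>2 * chi k k = - 4 * (S n + S (n + 2))"
      unfolding canonical_square using n4 an quad per'
      by (elim disjE) (simp_all add: m eval_nat_numeral)
    then have RK: "R\<^sup>2 * (- chi k k) = 4 * (S n + S (n + 2))" by simp
    have r_pos: "(r (idx t))\<^sup>2 \<ge> 1" for t using r_nonzero[OF idx_less[of t]] by (simp add: int_one_le_iff_zero_less)
    have S_le: "S t \<le> R\<^sup>2" for t
      using mult_left_mono[OF r_pos[of t], of "S t"] S_pos[of t] S_r[of t] by simp
    have "R\<^sup>2 * 8 \<le> R\<^sup>2 * (- chi k k)" using square m by (intro mult_left_mono) simp_all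
    then have "8 * R\<^sup>2 \<le> 4 * S n + 4 * S (n + 2)" unfolding RK by simp
    then have "S n = R\<^sup>2 \<and> S (n + 2) = R\<^sup>2" using S_le[of n] S_le[of "n + 2"] by linarith
    then have Seq: "S n = R\<^sup>2" "S (n + 2) = R\<^sup>2" by simp_all
    then have "R\<^sup>2 * (- chi k k) = R\<^sup>2 * 8" unfolding RK by simp
    then have "- chi k k = 8" using mult_left_cancel[of "R\<^sup>2" "- chi k k" 8] R_nonzero by force
    then have K: "chi k k = - 8" by simp
    have all_S: "S t = R\<^sup>2" if "t = n \<or> t = n + 1 \<or> t = n + 2 \<or> t = n + 3" for t
      using that Seq quad by auto
    have "(r t)\<^sup>2 = 1" if t: "t < m" for t
    proof -
      have "int t = n \<or> int t = n + 1 \<or> int t = n + 2 \<or> int t = n + 3 \<or>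
        int t + 4 = n \<or> int t + 4 = n + 1 \<or> int t + 4 = n + 2 \<or> int t + 4 = n + 3"
        using t m n4 by linarith
      then have "S (int t) = R\<^sup>2" using all_S[of "int t"] all_S[of "int t + 4"] per(1)[of "int t"] by auto
      then show ?thesis using S_r[of "int t"] idx_int[OF t] R_nonzero by simp
    qed
    then show ?thesis using K m by simp
  qed
  then show "\<And>i. i < m \<Longrightarrow> (r i)\<^sup>2 = 1" "chi k k = int m - 12" by simp_all
qed

end

section \<open>Norm-minimal exceptional bases\<close>

lemma norm_minimal_pair:
  assumes "\<And>ys. mutation chi (us @ [e, f] @ ws) ys \<Longrightarrow> rank_norm chi p (us @ [e, f] @ ws) \<le> rank_norm chi p ys"
    and "pseudolattice chi"
  shows "(chi p f)\<^sup>2 \<le> (chi p f - chi e f * chi p e)\<^sup>2" "(chi p e)\<^sup>2 \<le> (chi p e - chi e f * chi p f)\<^sup>2"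
proof -
  interpret pseudolattice chi by fact
  show "(chi p f)\<^sup>2 \<le> (chi p f - chi e f * chi p e)\<^sup>2"
    using assms(1)[OF mutation.left] by (simp add: left_mut_def)
  show "(chi p e)\<^sup>2 \<le> (chi p e - chi e f * chi p f)\<^sup>2"
    using assms(1)[OF mutation.right] by (simp add: right_mut_def)
qed

context canonical_surface
begin

text \<open>For \<open>f\<close> of rank \<open>\<plusminus>1\<close> and \<open>z\<close> of rank \<open>0\<close> one has \<open>\<chi>(f, z) = \<plusminus>\<chi>(kap, z)\<close>, so \<open>L\<^sub>f z\<close> has rank
  \<open>\<plusminus>1\<close>; the element \<open>f\<close> moves to the right and serves for the next \<open>z\<close>.\<close>

lemma mutations_make_ranks_units:
  assumes "exceptional_seq chi (f # zs)" "(chi p f)\<^sup>2 = 1"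
    and "\<And>z. z \<in> set zs \<Longrightarrow> chi p z = 0" "\<And>z. z \<in> set zs \<Longrightarrow> (chi kap z)\<^sup>2 = 1"
  shows "\<exists>gs. (mutation chi)\<^sup>*\<^sup>* (f # zs) gs \<and> (\<forall>g\<in>set gs. (chi p g)\<^sup>2 = 1)"
  using assms
proof (induction zs)
  case Nil
  then show ?case by (intro exI[of _ "[f]"]) simp
next
  case (Cons z zs)
  have "exceptional_seq chi (f # zs)" using Cons.prems(1) by (simp add: exceptional_seq_Cons)
  then obtain gs where gs: "(mutation chi)\<^sup>*\<^sup>* (f # zs) gs" "\<forall>g\<in>set gs. (chi p g)\<^sup>2 = 1"
    using Cons.IH Cons.prems by auto
  have "chi f z = chi p f * chi kap z"
    using chi_asym[of f z] Cons.prems by (simp add: exceptional_seq_Cons)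
  then have "chi p (left_mut chi f z) = - ((chi p f)\<^sup>2 * chi kap z)"
    using Cons.prems(3) by (simp add: left_mut_def power2_eq_square)
  then have "(chi p (left_mut chi f z))\<^sup>2 = 1" using Cons.prems by simp
  moreover have "(mutation chi)\<^sup>*\<^sup>* (f # z # zs) (left_mut chi f z # gs)"
    using converse_rtranclp_into_rtranclp[of "mutation chi", OF left_mutation mutations_Cons[OF gs(1)]] .
  ultimately show ?case using gs(2) by (intro exI[of _ "left_mut chi f z # gs"]) simp
qed

text \<open>The elements of rank \<open>0\<close> are pairwise orthogonal, because the form is symmetric on \<open>p\<^sup>\<bottom>\<close>.
  Projecting along them therefore maps onto the span of \<open>fs\<close>, and the projection of \<open>kap\<close> is its
  canonical class.\<close>

lemma split_zero_ranks:
  assumes eb: "exceptional_basis chi (fs @ zs)"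
    and fs: "\<And>f. f \<in> set fs \<Longrightarrow> chi p f \<noteq> 0" and zs: "\<And>z. z \<in> set zs \<Longrightarrow> chi p z = 0"
  obtains k where "nonzero_rank_sequence chi p fs k"
    "chi k k = chi kap kap - (\<Sum>z\<in>set zs. (chi kap z)\<^sup>2)"
proof -
  have seq: "exceptional_seq chi fs" "exceptional_seq chi zs"
    and zf: "\<And>f z. f \<in> set fs \<Longrightarrow> z \<in> set zs \<Longrightarrow> chi z f = 0"
    and span: "zmod.span (set (fs @ zs)) = UNIV"
    using eb by (auto simp: exceptional_basis_iff exceptional_seq_append)
  have zz: "chi z w = (if z = w then 1 else 0)" if zw: "z \<in> set zs" "w \<in> set zs" for z w
  proof -
    obtain i j where ij: "i < length zs" "z = zs ! i" "j < length zs" "w = zs ! j"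
      using zw unfolding in_set_conv_nth by blast
    have "distinct zs" using seq(2) by (rule exceptional_seq_distinct)
    then have "z = w \<longleftrightarrow> i = j" using ij by (simp add: nth_eq_iff_index_eq)
    moreover have "chi z w = chi w z" using chi_perp_commute zs zw by blast
    ultimately show ?thesis
      using exceptional_seq_nth[OF seq(2)] ij by (cases i j rule: linorder_cases) auto
  qed
  define proj where "proj v = v - (\<Sum>z\<in>set zs. zscale (chi z v) z)" for v
  have proj_fixed: "proj v = v" if "\<And>z. z \<in> set zs \<Longrightarrow> chi z v = 0" for v
    using that by (simp add: proj_def)
  have proj_zs: "proj w = 0" if w: "w \<in> set zs" for w
  proof -
    have "(\<Sum>z\<in>set zs. zscale (chi z w) z) = (\<Sum>z\<in>set zs. if z = w then w else 0)"
      using zz w by (intro sum.cong) auto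
    then show ?thesis using w by (simp add: proj_def)
  qed
  have proj_span: "proj v \<in> zmod.span (set fs)" for v
  proof -
    have "v \<in> zmod.span (set (fs @ zs))" using span by simp
    then show ?thesis
    proof (induction rule: zmod.span_induct_alt)
      case base
      then show ?case by (simp add: proj_def zmod.span_zero)
    next
      case (step c x y)
      have "proj x \<in> zmod.span (set fs)"
      proof (cases "x \<in> set fs")
        case True
        then show ?thesis using proj_fixed[of x] zf by (simp add: zmod.span_base)
      next
        case False
        then show ?thesis using step(1) proj_zs by (simp add: zmod.span_zero)
      qed
      moreover have "proj (zscale c x + y) = zscale c (proj x) + proj y"
        by (simp add: proj_def zmod.scale_left_distrib sum.distrib zmod.scale_right_diff_distrib
            zmod.scale_sum_right)
      ultimately show ?case using step(2) by (simp add: zmod.span_add zmod.span_scale)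
    qed
  qed
  have z_span: "chi z v = 0" if "z \<in> set zs" "v \<in> zmod.span (set fs)" for z v
    by (rule chi_span_right_zero[OF _ that(2)]) (rule zf[OF _ that(1)])
  define k where "k = proj kap"
  have k_span: "k \<in> zmod.span (set fs)" unfolding k_def by (rule proj_span)
  have k_eq: "chi k v = chi kap v" if "v \<in> zmod.span (set fs)" for v
  proof -
    have "chi (\<Sum>z\<in>set zs. zscale (chi z kap) z) v = 0"
      unfolding chi_sum by (intro sum.neutral ballI) (simp add: z_span[OF _ that])
    then show ?thesis by (simp add: k_def proj_def)
  qed
  have "proj p = p"
  proof (rule proj_fixed)
    show "chi z p = 0" if "z \<in> set zs" for z using zs[OF that] chi_point_commute[of z] by simp
  qed
  then have p_span: "p \<in> zmod.span (set fs)" using proj_span[of p] by simp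
  have "nonzero_rank_sequence chi p fs k"
  proof unfold_locales
    have "chi p (\<Sum>z\<in>set zs. zscale (chi z kap) z) = 0"
      unfolding chi_sum by (intro sum.neutral ballI) (simp add: zs)
    then show "chi p k = 0" using kap_perp by (simp add: k_def proj_def)
    show "chi u v - chi v u = chi p u * chi k v - chi p v * chi k u"
      if "u \<in> zmod.span (set fs)" "v \<in> zmod.span (set fs)" for u v
      using chi_asym[of u v] that by (simp add: k_eq)
  qed (use seq fs p_span k_span in auto)
  moreover have "chi k k = chi kap kap - (\<Sum>z\<in>set zs. (chi kap z)\<^sup>2)"
  proof -
    have "chi z kap = chi kap z" if "z \<in> set zs" for z
      using chi_perp_commute[of z kap] zs that kap_perp by simp
    then have "chi kap (\<Sum>z\<in>set zs. zscale (chi z kap) z) = (\<Sum>z\<in>set zs. (chi kap z)\<^sup>2)"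
      by (simp add: chi_sum power2_eq_square)
    then show ?thesis using k_eq[OF k_span] by (simp add: k_def proj_def)
  qed
  ultimately show ?thesis by (rule that)
qed

end

text \<open>The last pair of the cyclic system becomes adjacent after one step of the helix.\<close>

lemma (in nonzero_rank_sequence) helix_step:
  assumes xs: "xs = f # fs" and g: "g - f \<in> zmod.span (set fs)"
    and seq: "exceptional_seq chi (fs @ [g])" and l: "l = xs ! (m - 1)"
  shows "chi p g = chi p f" "chi l g = N (m - 1)"
proof -
  have m: "m = Suc (length fs)" unfolding m_def by (simp add: xs)
  then have "length fs > 0" using m_ge_3 by linarith
  have "l = (f # fs) ! length fs" using l unfolding m by (simp add: xs)
  then have "l = fs ! (length fs - 1)" using \<open>length fs > 0\<close> by (simp add: nth_Cons')
  then have l_mem: "l \<in> set fs" using \<open>length fs > 0\<close> by simp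
  have sub: "zmod.span (set fs) \<subseteq> zmod.span (set xs)"
    unfolding xs by (rule zmod.span_mono) auto
  have f_span: "f \<in> zmod.span (set xs)" "l \<in> zmod.span (set xs)"
    by (rule zmod.span_base, simp add: xs l_mem)+
  have "(g - f) + f \<in> zmod.span (set xs)" using subsetD[OF sub g] f_span(1) by (rule zmod.span_add)
  then have g_span: "g \<in> zmod.span (set xs)" by simp
  have fs_f: "chi h f = 0" if "h \<in> set fs" for h
    using exceptional that by (simp add: xs exceptional_seq_Cons)
  have g_fs: "chi g h = 0" if "h \<in> set fs" for h
    using seq that by (simp add: exceptional_seq_append)
  have "chi (g - f) f = 0" by (rule chi_span_left_zero[OF _ g]) (rule fs_f)
  then have gf: "chi g f = 1" using exceptional by (simp add: xs exceptional_seq_Cons)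
  \<comment> \<open>\<open>g\<close> is the image of \<open>f\<close> under the inverse of the Serre operator.\<close>
  have serre: "chi g v = chi v f" if "v \<in> zmod.span (set xs)" for v
  proof (rule additive_eq_on_span[OF chi_additive_right chi_additive_left _ that])
    fix e assume "e \<in> set xs"
    then have "e = f \<or> e \<in> set fs" by (simp add: xs)
    moreover have "chi f f = 1" using exceptional by (simp add: xs exceptional_seq_Cons)
    ultimately show "chi g e = chi e f" using gf g_fs fs_f by auto
  qed
  show rank: "chi p g = chi p f"
    using serre[OF point_in_span] chi_point_commute[of g] by simp
  have kg: "chi k g = chi k f - chi p f * chi k k"
    using asym[OF k_in_span g_span] serre[OF k_in_span] k_perp rank by simp
  have lg: "chi l g = chi p l * chi k g - chi p f * chi k l"
    using asym[OF f_span(2) g_span] g_fs[OF l_mem] rank by simp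
  have N_last: "N (m - 1) = chi p l * chi k f - chi p f * chi k l - chi p f * chi p l * chi k k"
  proof -
    have "Suc (m - 1) = m" "xs ! 0 = f" using m by (simp_all add: xs)
    then show ?thesis by (simp add: N_def r_def l)
  qed
  show "chi l g = N (m - 1)" unfolding lg kg N_last by (simp add: algebra_simps)
qed

section \<open>Reduction to rank one\<close>

theorem theorem5p9:
  fixes chi :: "'a::ab_group_add \<Rightarrow> 'a \<Rightarrow> int" and p :: 'a and es :: "'a list"
  assumes "geometric_pseudolattice chi p"
    and "defect chi p = 0"
    and "exceptional_basis chi es"
  shows "\<exists>fs gs. (mutation chi)\<^sup>*\<^sup>* es fs \<and> equal_up_to_signs fs gs \<and>
           exceptional_basis chi gs \<and> (\<forall>g\<in>set gs. elt_rank chi p g = 1)"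
proof -
  obtain kap where geo: "geometric_surface chi p kap" and square: "chi kap kap = int (length es) - 12"
    using geometric_defect_zero_imp_geometric_surface[OF assms] by blast
  interpret geometric_surface chi p kap by (rule geo)
  have pseudo: "pseudolattice chi" by unfold_locales
  obtain es' where es': "(mutation chi)\<^sup>*\<^sup>* es es'"
    and least: "\<And>ys. (mutation chi)\<^sup>*\<^sup>* es ys \<Longrightarrow> nat (rank_norm chi p es') \<le> nat (rank_norm chi p ys)"
    using ex_has_least_nat[of "(mutation chi)\<^sup>*\<^sup>* es" es "\<lambda>ys. nat (rank_norm chi p ys)"] by auto
  obtain fs zs where fz: "(mutation chi)\<^sup>*\<^sup>* es' (fs @ zs)" "\<And>f. f \<in> set fs \<Longrightarrow> chi p f \<noteq> 0"
      "\<And>z. z \<in> set zs \<Longrightarrow> chi p z = 0" "rank_norm chi p (fs @ zs) = rank_norm chi p es'"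
    using mutations_zero_ranks_last[of es' p] by blast
  have reach: "(mutation chi)\<^sup>*\<^sup>* es (fs @ zs)" using es' fz(1) by (rule rtranclp_trans)
  have minimal: "rank_norm chi p (fs @ zs) \<le> rank_norm chi p ys"
    if "(mutation chi)\<^sup>*\<^sup>* (fs @ zs) ys" for ys
    using least[OF rtranclp_trans[OF reach that]] rank_norm_nonneg[of chi p ys]
    unfolding fz(4) by (simp add: nat_le_eq_zle)
  have eb: "exceptional_basis chi (fs @ zs)" using reach assms(3) by (rule mutations_exceptional_basis)
  have seq: "exceptional_seq chi (fs @ zs)" using eb by (simp add: exceptional_basis_def)
  obtain k where "nonzero_rank_sequence chi p fs k"
    and kk: "chi k k = chi kap kap - (\<Sum>z\<in>set zs. (chi kap z)\<^sup>2)"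
    using split_zero_ranks[OF eb fz(2,3)] by blast
  then interpret seq: nonzero_rank_sequence chi p fs k by simp
  have m: "seq.m = length fs" by (simp add: seq.m_def)
  have len: "length es = length fs + length zs" using mutations_length[OF reach] by simp
  have card_zs: "card (set zs) = length zs"
    using seq exceptional_seq_distinct by (simp add: exceptional_seq_append distinct_card)

  have minimal_pairs: "(seq.r (seq.nxt i))\<^sup>2 \<le> (seq.r (seq.nxt i) - seq.N i * seq.r i)\<^sup>2 \<and>
      (seq.r i)\<^sup>2 \<le> (seq.r i - seq.N i * seq.r (seq.nxt i))\<^sup>2" if i: "i < seq.m" for i
  proof (cases "Suc i = seq.m")
    case False
    then have Si: "Suc i < length fs" using i m by simp
    have split: "fs @ zs = take i fs @ [fs ! i, fs ! Suc i] @ (drop (Suc (Suc i)) fs @ zs)"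
      using Si by (simp add: Cons_nth_drop_Suc append_take_drop_id flip: append_assoc)
    have "rank_norm chi p (take i fs @ [fs ! i, fs ! Suc i] @ (drop (Suc (Suc i)) fs @ zs)) \<le> rank_norm chi p ys"
      if "mutation chi (take i fs @ [fs ! i, fs ! Suc i] @ (drop (Suc (Suc i)) fs @ zs)) ys" for ys
      using minimal[of ys] that unfolding split[symmetric] by blast
    from norm_minimal_pair[OF this pseudo] show ?thesis
      using False by (simp add: seq.r_def seq.nxt_def seq.N_def)
  next
    case True
    obtain f fs' where fs: "fs = f # fs'" using seq.m_ge_3 m by (cases fs) auto
    then have fs'_ne: "fs' \<noteq> []" using seq.m_ge_3 m by auto
    define l where "l = last fs'"
    have "last fs = l" using fs'_ne by (simp add: fs l_def)
    moreover have "fs \<noteq> []" by (simp add: fs)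
    ultimately have l: "l = fs ! (seq.m - 1)" unfolding m using last_conv_nth by metis
    obtain g where g: "(mutation chi)\<^sup>*\<^sup>* (f # fs' @ zs) (fs' @ g # zs)" "g - f \<in> zmod.span (set fs')"
      using mutations_move_right by blast
    have "exceptional_basis chi (fs' @ g # zs)"
      using g(1) eb unfolding fs by (auto intro: mutations_exceptional_basis)
    then have "exceptional_seq chi ((fs' @ [g]) @ zs)" by (simp add: exceptional_basis_def)
    then have "exceptional_seq chi (fs' @ [g])" unfolding exceptional_seq_append[of "fs' @ [g]"] by blast
    from seq.helix_step[OF fs g(2) this l]
    have helix: "chi p g = chi p f" "chi l g = seq.N (seq.m - 1)" by simp_all
    have split: "fs' @ g # zs = butlast fs' @ [l, g] @ zs"
      using append_butlast_last_id[OF fs'_ne] unfolding l_def by (metis append.assoc append_Cons append_Nil)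
    have norm: "rank_norm chi p (fs' @ g # zs) = rank_norm chi p (fs @ zs)"
      using helix(1) by (simp add: fs)
    have "rank_norm chi p (butlast fs' @ [l, g] @ zs) \<le> rank_norm chi p ys"
      if "mutation chi (butlast fs' @ [l, g] @ zs) ys" for ys
    proof -
      have "(mutation chi)\<^sup>*\<^sup>* (fs @ zs) ys"
        using rtranclp.rtrancl_into_rtrancl[OF g(1)] that unfolding split fs by simp
      then show ?thesis using minimal[of ys] norm unfolding split by simp
    qed
    note pair = norm_minimal_pair[OF this pseudo]
    have i_last: "i = seq.m - 1" using True by simp
    have "seq.r i = chi p l" unfolding seq.r_def l i_last ..
    moreover have "seq.nxt i = 0" using True by (simp add: seq.nxt_def)
    moreover have "seq.r 0 = chi p g" unfolding seq.r_def helix(1) by (simp add: fs)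
    moreover have "seq.N i = chi l g" unfolding helix(2) i_last ..
    ultimately show ?thesis using pair by simp
  qed
  interpret minimal_sequence chi p fs k kap
    by unfold_locales (use minimal_pairs in auto)

  \<comment> \<open>By parity every element of rank \<open>0\<close> has odd degree; the inequality for \<open>k\<close> leaves no room
    for degrees other than \<open>1\<close> and \<open>-1\<close>.\<close>
  have odd_degree: "(chi kap z)\<^sup>2 \<ge> 1" if z: "z \<in> set zs" for z
  proof -
    have "chi z z = 1" using seq z by (simp add: exceptional_seq_def)
    then have "odd (chi kap z)" using parity[of z] fz(3)[OF z] by simp
    then have "chi kap z \<noteq> 0" by auto
    then show ?thesis by (simp add: int_one_le_iff_zero_less)
  qed
  then have "(\<Sum>z\<in>set zs. 1) \<le> (\<Sum>z\<in>set zs. (chi kap z)\<^sup>2)" by (rule sum_mono)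
  then have "chi k k \<le> int seq.m - 12" using kk square len m card_zs by simp
  note units = ranks_are_units[OF this]
  have fs_units: "(chi p f)\<^sup>2 = 1" if "f \<in> set fs" for f
    using units(1) that by (auto simp: in_set_conv_nth m seq.r_def)
  have "(\<Sum>z\<in>set zs. (chi kap z)\<^sup>2 - 1) = 0"
    using units(2) kk square len m card_zs by (simp add: sum_subtractf)
  moreover have "0 \<le> (chi kap z)\<^sup>2 - 1" if "z \<in> set zs" for z using odd_degree[OF that] by linarith
  ultimately have "\<forall>z\<in>set zs. (chi kap z)\<^sup>2 - 1 = 0" by (subst (asm) sum_nonneg_eq_0_iff) simp_all
  then have zs_units: "(chi kap z)\<^sup>2 = 1" if "z \<in> set zs" for z using that by simp

  have "fs \<noteq> []" using seq.m_ge_3 m by auto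
  then have fs_split: "fs = butlast fs @ [last fs]" by simp
  have "exceptional_seq chi (last fs # zs)"
    using seq by (subst (asm) fs_split) (simp add: exceptional_seq_append exceptional_seq_Cons)
  then obtain gs where gs: "(mutation chi)\<^sup>*\<^sup>* (last fs # zs) gs" "\<forall>g\<in>set gs. (chi p g)\<^sup>2 = 1"
    using mutations_make_ranks_units[of "last fs" zs] fs_units \<open>fs \<noteq> []\<close> fz(3) zs_units by auto
  define hs where "hs = butlast fs @ gs"
  have "(mutation chi)\<^sup>*\<^sup>* (butlast fs @ last fs # zs) hs"
    unfolding hs_def by (rule mutations_append_left) (rule gs(1))
  moreover have "butlast fs @ last fs # zs = fs @ zs" using fs_split by (metis append.assoc append_Cons append_Nil)
  ultimately have hs: "(mutation chi)\<^sup>*\<^sup>* es hs" using reach by (auto intro: rtranclp_trans)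
  have hs_units: "(chi p h)\<^sup>2 = 1" if "h \<in> set hs" for h
    using that gs(2) fs_units by (auto simp: hs_def dest: in_set_butlastD)
  define hs' where "hs' = map (\<lambda>h. if chi p h = 1 then h else - h) hs"
  have signs: "equal_up_to_signs hs hs'"
    by (simp add: equal_up_to_signs_def hs'_def list_all2_conv_all_nth)
  have "exceptional_basis chi hs'"
    using signs mutations_exceptional_basis[OF hs assms(3)] by (rule exceptional_basis_signs)
  moreover have "\<forall>h\<in>set hs'. elt_rank chi p h = 1"
    using hs_units by (fastforce simp: hs'_def elt_rank_def power2_eq_1_iff)
  ultimately show ?thesis using hs signs by blast
qed

end
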